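(* Let $X$ be a symmetrically self-similar graph with return function $f$, branching number $\beta$ and resistance scaling factor $\rho$. Then $f(1)=\beta\rho$.
   Context: Graphs $X=(VX,EX)$ are undirected, without loops or multiple edges. The boundary $\theta C$ of $C\subset VX$ is the set of vertices in $VX\setminus C$ which are adjacent to some vertex in $C$, and $\hat C$ denotes the subgraph of $X$ spanned by $C\cup\theta C$, with vertex set $V\hat C$. For $F\subset VX$ let $\mathcal C_X(F)$ be the set of connected components of $VX\setminus F$. The reduced graph $X_F$ has vertex set $VX_F=F$, and two vertices $x,y\in F$ are joined by an edge of $X_F$ if and only if there is a $C\in\mathcal C_X(F)$ with $x,y\in\theta C$. A connected infinite graph $X$ is self-similar with respect to $F\subset VX$ and $\psi:VX\to VX_F$ if (F1) no vertices in $F$ are adjacent in $X$; (F2) the intersection of the boundaries of two different components in $\mathcal C_X(F)$ contains not more than one vertex; (F3) $\psi$ is an isomorphism between $X$ and $X_F$. Write $\phi=\psi^{-1}$. The components in $\mathcal C_X(F)$ are called cells (1-cells), and $\hat C$ is the cell graph of a cell $C$. The 2-cells are the connected components of $VX\setminus\psi(F)$. A self-similar graph $X$ is symmetrically self-similar if it is locally finite and: (S1) all cells are finite and for any pair of cells $C,D$ there exists an isomorphism $\alpha$ of $\hat C$ and $\hat D$ such that $\alpha(\theta C)=\theta D$; (S2) the automorphism group $\mathrm{Aut}(\hat C)$ acts doubly transitively on $\theta C$, i.e. it acts transitively on $\{(x,y)\mid x,y\in\theta C,\ x\ne y\}$. The number $\theta$ is the number of vertices in the boundary of a cell. For a cell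 $C$ there is exactly one 2-cell $C_2$ with $\psi(C)\subset C_2$; let $C^1,\dots,C^\mu$ be the 1-cells contained in $C_2$. Their number $\mu$ (the mass scaling factor) does not depend on the 2-cell. The cell graph $\hat C$ consists of $\mu$ amalgamated complete graphs $K_\theta^1,\dots,K_\theta^\mu$ with $\theta$ vertices, where $VK_\theta^i=\phi(\theta C^i)$. For $v\in V\hat C$ the branching number is $\beta(v)=|\{i\in\{1,\dots,\mu\}\mid v\in VK_\theta^i\}|$. The branching number $\beta$ of $X$ is $\beta(v)$ for any $v\in\theta C$ (independent of $v$ and $C$). For a cell $C$ and nonempty $B\subset\theta C$, let $Q_B=(q_B(x,y))_{x,y\in V\hat C}$ with $q_B(x,y)=1/\deg_{\hat C}(x)$ if $x\in V\hat C\setminus B$ is adjacent to $y$ in $\hat C$, and $q_B(x,y)=0$ otherwise; let $Q_B^*(z)=(I-zQ_B)^{-1}$, a matrix of rational functions in $z$ which are holomorphic in a disk around $0$ of radius $>1$. For $v\in\theta C$ the transition function $d$ and the return function $f$ are the rational functions $$d(z)=\sum_{w\in\theta C\setminus\{v\}}\bigl(Q^*_{\theta C\setminus\{v\}}(z)\bigr)_{v,w},\qquad f(z)=\bigl(Q^*_{\theta C\setminus\{v\}}(z)\bigr)_{v,v};$$ they are independent of $v$ and $C$. The time scaling factor is $\tau=d'(1)$. The resistance scaling factor $\rho$ is defined by $\tau=\mu\rho$. *)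

theory Defs
  imports "HOL-Complex_Analysis.Complex_Analysis"
begin

section \<open>Graphs\<close>

record 'a graph =
  verts :: "'a set"
  edges :: "'a set set"

definition simple_graph :: "'a graph \<Rightarrow> bool" where
  "simple_graph X \<longleftrightarrow>
     edges X \<subseteq> {{x, y} | x y. x \<in> verts X \<and> y \<in> verts X \<and> x \<noteq> y}"

definition adj :: "'a graph \<Rightarrow> 'a \<Rightarrow> 'a \<Rightarrow> bool" where
  "adj X x y \<longleftrightarrow> {x, y} \<in> edges X"

definition neighbours :: "'a graph \<Rightarrow> 'a \<Rightarrow> 'a set" where
  "neighbours X x = {y. adj X x y}"

definition degree :: "'a graph \<Rightarrow> 'a \<Rightarrow> nat" where
  "degree X x = card (neighbours X x)"

definition locally_finite_graph :: "'a graph \<Rightarrow> bool" where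
  "locally_finite_graph X \<longleftrightarrow> (\<forall>x \<in> verts X. finite (neighbours X x))"

definition induced_subgraph :: "'a graph \<Rightarrow> 'a set \<Rightarrow> 'a graph" where
  "induced_subgraph X S =
     \<lparr>verts = verts X \<inter> S, edges = {e \<in> edges X. e \<subseteq> S}\<rparr>"

definition connected_graph :: "'a graph \<Rightarrow> bool" where
  "connected_graph X \<longleftrightarrow>
     verts X \<noteq> {} \<and> (\<forall>x \<in> verts X. \<forall>y \<in> verts X. (adj X)\<^sup>*\<^sup>* x y)"

definition graph_iso :: "('a \<Rightarrow> 'b) \<Rightarrow> 'a graph \<Rightarrow> 'b graph \<Rightarrow> bool" where
  "graph_iso f X Y \<longleftrightarrow>
     bij_betw f (verts X) (verts Y) \<and>
     (\<forall>x \<in> verts X. \<forall>y \<in> verts X. adj X x y \<longleftrightarrow> adj Y (f x) (f y))"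

definition boundary :: "'a graph \<Rightarrow> 'a set \<Rightarrow> 'a set" where
  "boundary X C = {x \<in> verts X - C. \<exists>y \<in> C. adj X x y}"

definition closure_graph :: "'a graph \<Rightarrow> 'a set \<Rightarrow> 'a graph" where
  "closure_graph X C = induced_subgraph X (C \<union> boundary X C)"

definition complement_components :: "'a graph \<Rightarrow> 'a set \<Rightarrow> 'a set set" where
  "complement_components X F =
     {{y. (adj (induced_subgraph X (verts X - F)))\<^sup>*\<^sup>* x y} | x. x \<in> verts X - F}"

section \<open>Self-similar graphs\<close>

definition reduced_graph :: "'a graph \<Rightarrow> 'a set \<Rightarrow> 'a graph" where
  "reduced_graph X F =
     \<lparr>verts = F,
      edges = {{x, y} | x y. x \<in> F \<and> y \<in> F \<and> x \<noteq> y \<and>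
        (\<exists>C \<in> complement_components X F. x \<in> boundary X C \<and> y \<in> boundary X C)}\<rparr>"

text \<open>The condition that a set contains at most one vertex is stated elementwise, because
  \<^const>\<open>card\<close> is 0 on infinite sets.\<close>

definition self_similar :: "'a graph \<Rightarrow> 'a set \<Rightarrow> ('a \<Rightarrow> 'a) \<Rightarrow> bool" where
  "self_similar X F \<psi> \<longleftrightarrow>
     simple_graph X \<and> connected_graph X \<and> infinite (verts X) \<and> F \<subseteq> verts X \<and>
     (\<forall>x \<in> F. \<forall>y \<in> F. \<not> adj X x y) \<and>
     (\<forall>C \<in> complement_components X F. \<forall>D \<in> complement_components X F. C \<noteq> D \<longrightarrow>
        (\<forall>x \<in> boundary X C \<inter> boundary X D. \<forall>y \<in> boundary X C \<inter> boundary X D. x = y)) \<and>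
     graph_iso \<psi> X (reduced_graph X F)"

abbreviation cells :: "'a graph \<Rightarrow> 'a set \<Rightarrow> 'a set set" where
  "cells X F \<equiv> complement_components X F"

abbreviation two_cells :: "'a graph \<Rightarrow> 'a set \<Rightarrow> ('a \<Rightarrow> 'a) \<Rightarrow> 'a set set" where
  "two_cells X F \<psi> \<equiv> complement_components X (\<psi> ` F)"

text \<open>In the last clause the automorphisms are those of the cell graph, and the orbit condition
  is imposed on pairs only: an automorphism need not map the whole boundary of the cell to itself.
  (The 4-cycle with two opposite boundary vertices is a typical cell graph having automorphisms
  that do not.)\<close>

definition symmetrically_self_similar :: "'a graph \<Rightarrow> 'a set \<Rightarrow> ('a \<Rightarrow> 'a) \<Rightarrow> bool" where
  "symmetrically_self_similar X F \<psi> \<longleftrightarrow>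
     self_similar X F \<psi> \<and> locally_finite_graph X \<and>
     (\<forall>C \<in> cells X F. finite C) \<and>
     (\<forall>C \<in> cells X F. \<forall>D \<in> cells X F. \<exists>\<alpha>.
        graph_iso \<alpha> (closure_graph X C) (closure_graph X D) \<and>
        \<alpha> ` boundary X C = boundary X D) \<and>
     (\<forall>C \<in> cells X F. \<forall>x \<in> boundary X C. \<forall>y \<in> boundary X C.
        \<forall>x' \<in> boundary X C. \<forall>y' \<in> boundary X C. x \<noteq> y \<longrightarrow> x' \<noteq> y' \<longrightarrow>
        (\<exists>\<alpha>. graph_iso \<alpha> (closure_graph X C) (closure_graph X C) \<and> \<alpha> x = x' \<and> \<alpha> y = y'))"

section \<open>Mass scaling factor and branching number\<close>

text \<open>Below, a constant of the graph that does not depend on the choice of a cell, a 2-cell or a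
  boundary vertex is rendered as the unique common value over all choices.\<close>

definition subcells :: "'a graph \<Rightarrow> 'a set \<Rightarrow> 'a set \<Rightarrow> 'a set set" where
  "subcells X F C2 = {D \<in> cells X F. D \<subseteq> C2}"

definition mass_scaling :: "'a graph \<Rightarrow> 'a set \<Rightarrow> ('a \<Rightarrow> 'a) \<Rightarrow> nat" where
  "mass_scaling X F \<psi> = (THE m. \<forall>C2 \<in> two_cells X F \<psi>. card (subcells X F C2) = m)"

definition two_cell_of :: "'a graph \<Rightarrow> 'a set \<Rightarrow> ('a \<Rightarrow> 'a) \<Rightarrow> 'a set \<Rightarrow> 'a set" where
  "two_cell_of X F \<psi> C = (THE C2. C2 \<in> two_cells X F \<psi> \<and> \<psi> ` C \<subseteq> C2)"

text \<open>The complete graphs that make up the cell graph of \<open>C\<close> are indexed by the 1-cells \<open>D\<close> in the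
  2-cell of \<open>C\<close>; the one belonging to \<open>D\<close> has vertex set \<open>\<psi>\<close>\<open>\<inverse>\<close> applied to the boundary of \<open>D\<close>.\<close>

definition vertex_branching ::
    "'a graph \<Rightarrow> 'a set \<Rightarrow> ('a \<Rightarrow> 'a) \<Rightarrow> 'a set \<Rightarrow> 'a \<Rightarrow> nat" where
  "vertex_branching X F \<psi> C v =
     card {D \<in> subcells X F (two_cell_of X F \<psi> C). v \<in> inv_into (verts X) \<psi> ` boundary X D}"

definition branching_number :: "'a graph \<Rightarrow> 'a set \<Rightarrow> ('a \<Rightarrow> 'a) \<Rightarrow> nat" where
  "branching_number X F \<psi> =
     (THE b. \<forall>C \<in> cells X F. \<forall>v \<in> boundary X C. vertex_branching X F \<psi> C v = b)"

section \<open>Transition and return functions\<close>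

text \<open>Matrices indexed by a finite set \<open>S\<close> are functions \<open>'a \<Rightarrow> 'a \<Rightarrow> complex\<close> of which only the
  entries in \<open>S \<times> S\<close> matter. The inverse is normalised to be 0 outside \<open>S \<times> S\<close>; it is meaningful
  only if the matrix is invertible.\<close>

definition matrix_inverse_on :: "'a set \<Rightarrow> ('a \<Rightarrow> 'a \<Rightarrow> complex) \<Rightarrow> 'a \<Rightarrow> 'a \<Rightarrow> complex" where
  "matrix_inverse_on S A =
     (THE M. (\<forall>x y. x \<notin> S \<or> y \<notin> S \<longrightarrow> M x y = 0) \<and>
        (\<forall>x \<in> S. \<forall>y \<in> S. (\<Sum>k\<in>S. A x k * M k y) = of_bool (x = y)) \<and>
        (\<forall>x \<in> S. \<forall>y \<in> S. (\<Sum>k\<in>S. M x k * A k y) = of_bool (x = y)))"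

definition Q_matrix :: "'a graph \<Rightarrow> 'a set \<Rightarrow> 'a set \<Rightarrow> 'a \<Rightarrow> 'a \<Rightarrow> complex" where
  "Q_matrix X C B x y =
     (if x \<in> verts (closure_graph X C) - B \<and> adj (closure_graph X C) x y
      then 1 / of_nat (degree (closure_graph X C) x) else 0)"

text \<open>The matrix \<open>(I - zQ)\<close>\<open>\<inverse>\<close> is evaluated pointwise at complex \<open>z\<close>. Since \<open>I - zQ\<close> is invertible
  for \<open>z\<close> in a neighbourhood of the closed unit disk, the values and derivatives at 1 are those of
  the corresponding rational functions.\<close>

definition Q_star :: "'a graph \<Rightarrow> 'a set \<Rightarrow> 'a set \<Rightarrow> complex \<Rightarrow> 'a \<Rightarrow> 'a \<Rightarrow> complex" where
  "Q_star X C B z =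
     matrix_inverse_on (verts (closure_graph X C))
       (\<lambda>x y. of_bool (x = y) - z * Q_matrix X C B x y)"

definition transition_function :: "'a graph \<Rightarrow> 'a set \<Rightarrow> 'a \<Rightarrow> complex \<Rightarrow> complex" where
  "transition_function X C v z =
     (\<Sum>w \<in> boundary X C - {v}. Q_star X C (boundary X C - {v}) z v w)"

definition return_function :: "'a graph \<Rightarrow> 'a set \<Rightarrow> 'a \<Rightarrow> complex \<Rightarrow> complex" where
  "return_function X C v z = Q_star X C (boundary X C - {v}) z v v"

definition time_scaling :: "'a graph \<Rightarrow> 'a set \<Rightarrow> complex" where
  "time_scaling X F =
     (THE t. \<forall>C \<in> cells X F. \<forall>v \<in> boundary X C. deriv (transition_function X C v) 1 = t)"

definition resistance_scaling :: "'a graph \<Rightarrow> 'a set \<Rightarrow> ('a \<Rightarrow> 'a) \<Rightarrow> complex" where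
  "resistance_scaling X F \<psi> = time_scaling X F / of_nat (mass_scaling X F \<psi>)"

end

theory Submission
  imports Defs "Jordan_Normal_Form.Determinant"
begin

text \<open>On the cell graph of \<open>C\<close> let \<open>H\<^sub>w(x)\<close> be the expected time in which simple random walk
  started at \<open>x\<close> hits \<open>w\<close>. Uniqueness of solutions of the Dirichlet problem makes \<open>H\<close> invariant under
  isomorphisms, so by double transitivity \<open>H\<^sub>w(x) = h\<close> for all distinct boundary vertices \<open>x\<close>, \<open>w\<close>;
  it does not matter that the automorphisms may move the boundary. With \<open>\<theta>\<close> boundary vertices and
  \<open>B = \<theta>C - {v}\<close>, the expected time to hit \<open>B\<close> is \<open>((\<Sum>w\<in>B. H\<^sub>w) - (\<theta> - 2) h) / (\<theta> - 1)\<close>, and the Green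
  function with pole \<open>v\<close> is proportional to \<open>(\<Sum>w\<in>B. H\<^sub>w) - (\<theta> - 1) H\<^sub>v + h\<close>. Evaluating at \<open>v\<close> gives
  \<open>\<tau> = h / (\<theta> - 1)\<close> and \<open>f(1) = \<tau> \<theta> deg v / \<Sum>deg\<close>. Since the cell graph is a union of \<open>\<mu>\<close> edge-disjoint
  copies of \<open>K\<^sub>\<theta>\<close>, of which \<open>\<beta>\<close> contain \<open>v\<close>, the degrees are \<open>deg v = \<beta> (\<theta> - 1)\<close> and
  \<open>\<Sum>deg = \<mu> \<theta> (\<theta> - 1)\<close>, hence \<open>f(1) = \<beta> \<tau> / \<mu>\<close>.\<close>

section \<open>Resolvents of finite matrices\<close>

text \<open>The body of the definite description in \<open>matrix_inverse_on\<close>, named so that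
  existence and uniqueness can be argued separately. The vanishing off \<open>S\<close> makes the
  inverse unique as a function on the whole type.\<close>

definition is_inverse_on :: "'a set \<Rightarrow> ('a \<Rightarrow> 'a \<Rightarrow> complex) \<Rightarrow> ('a \<Rightarrow> 'a \<Rightarrow> complex) \<Rightarrow> bool" where
  "is_inverse_on S A M \<longleftrightarrow>
     (\<forall>x y. x \<notin> S \<or> y \<notin> S \<longrightarrow> M x y = 0) \<and>
     (\<forall>x \<in> S. \<forall>y \<in> S. (\<Sum>k\<in>S. A x k * M k y) = of_bool (x = y)) \<and>
     (\<forall>x \<in> S. \<forall>y \<in> S. (\<Sum>k\<in>S. M x k * A k y) = of_bool (x = y))"

lemma sum_of_bool_eq_mult:
  fixes u :: "'a \<Rightarrow> complex"
  assumes "finite S" "x \<in> S"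
  shows "(\<Sum>k\<in>S. of_bool (x = k) * u k) = u x"
proof -
  have "(\<Sum>k\<in>S. of_bool (x = k) * u k) = (\<Sum>k\<in>S. if x = k then u k else 0)"
    by (rule sum.cong) auto
  then show ?thesis using assms by simp
qed

text \<open>Multiply \<open>A u = b\<close> by \<open>M\<close> from the left. A sum against a row
  of an inverse can thus be evaluated by exhibiting a solution \<open>u\<close>.\<close>

lemma left_inverse_solve:
  fixes A M :: "'a \<Rightarrow> 'a \<Rightarrow> complex"
  assumes "finite S"
    and "\<forall>x\<in>S. \<forall>y\<in>S. (\<Sum>k\<in>S. M x k * A k y) = of_bool (x = y)"
    and "\<And>x. x \<in> S \<Longrightarrow> (\<Sum>k\<in>S. A x k * u k) = b x"
    and "x \<in> S"
  shows "u x = (\<Sum>k\<in>S. M x k * b k)"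
proof -
  have "(\<Sum>k\<in>S. M x k * b k) = (\<Sum>k\<in>S. M x k * (\<Sum>j\<in>S. A k j * u j))"
    using assms(3) by simp
  also have "\<dots> = (\<Sum>k\<in>S. \<Sum>j\<in>S. M x k * A k j * u j)"
    by (simp add: sum_distrib_left mult.assoc)
  also have "\<dots> = (\<Sum>j\<in>S. \<Sum>k\<in>S. M x k * A k j * u j)"
    by (rule sum.swap)
  also have "\<dots> = (\<Sum>j\<in>S. of_bool (x = j) * u j)"
    using assms(2,4) by (simp flip: sum_distrib_right)
  also have "\<dots> = u x"
    using assms(1,4) by (rule sum_of_bool_eq_mult)
  finally show ?thesis by simp
qed

lemma is_inverse_on_unique:
  assumes "finite S" "is_inverse_on S A M" "is_inverse_on S A N"
  shows "M = N"
proof (intro ext)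
  fix x y
  show "M x y = N x y"
  proof (cases "x \<in> S \<and> y \<in> S")
    case True
    have "N x y = (\<Sum>k\<in>S. M x k * of_bool (k = y))"
      using left_inverse_solve[of S M A "\<lambda>k. N k y" "\<lambda>k. of_bool (k = y)" x] assms True
      unfolding is_inverse_on_def by simp
    also have "\<dots> = M x y"
      using assms(1) True by (simp add: of_bool_def if_distrib cong: if_cong)
    finally show ?thesis by simp
  next
    case False
    then show ?thesis using assms(2,3) unfolding is_inverse_on_def by metis
  qed
qed

text \<open>An enumeration of \<open>S\<close> turns \<open>A\<close> into a square matrix with
  numeric indices. A vanishing determinant would give a nonzero kernel vector there, contradicting
  \<open>ker\<close>; the inverse is carried back along the enumeration.\<close>

lemma ex_inverse_on:
  assumes fin: "finite S"
    and ker: "\<And>u. (\<And>x. x \<in> S \<Longrightarrow> (\<Sum>k\<in>S. A x k * u k) = 0) \<Longrightarrow> \<forall>x\<in>S. u x = 0"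
  shows "\<exists>M. is_inverse_on S A M"
proof -
  define n where "n = card S"
  obtain f where f: "bij_betw f {0..<n} S"
    using ex_bij_betw_nat_finite[OF fin] unfolding n_def by auto
  define g where "g = the_inv_into {0..<n} f"
  have g: "g x < n" "f (g x) = x" if "x \<in> S" for x
    using f that unfolding g_def
    using the_inv_into_into[of f "{0..<n}" x, OF _ _ subset_refl]
    by (auto simp: bij_betw_def f_the_inv_into_f)
  have gf: "g (f i) = i" "f i \<in> S" if "i < n" for i
    using f that unfolding g_def by (auto simp: bij_betw_def the_inv_into_f_f)
  define A' where "A' = Matrix.mat n n (\<lambda>(i,j). A (f i) (f j))"
  have A': "A' \<in> carrier_mat n n" by (simp add: A'_def)
  have sumS: "(\<Sum>k\<in>S. h k) = (\<Sum>i\<in>{0..<n}. h (f i))" for h :: "'a \<Rightarrow> complex"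
    using sum.reindex_bij_betw[OF f, of h] by simp
  have "Determinant.det A' \<noteq> 0"
  proof
    assume "Determinant.det A' = 0"
    then obtain w where w: "w \<in> carrier_vec n" "w \<noteq> 0\<^sub>v n" "A' *\<^sub>v w = 0\<^sub>v n"
      using det_0_iff_vec_prod_zero[OF A'] by auto
    have "\<forall>x\<in>S. vec_index w (g x) = 0"
    proof (rule ker)
      fix x assume x: "x \<in> S"
      have "(\<Sum>k\<in>S. A x k * vec_index w (g k)) = vec_index (A' *\<^sub>v w) (g x)"
        using g[OF x] w(1) gf by (simp add: sumS A'_def scalar_prod_def)
      also have "\<dots> = 0" using g[OF x] w(3) by simp
      finally show "(\<Sum>k\<in>S. A x k * vec_index w (g k)) = 0" .
    qed
    then have "w = 0\<^sub>v n"
      using w(1) gf by (intro eq_vecI) (auto, metis)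
    with w(2) show False by simp
  qed
  then obtain B where B: "B \<in> carrier_mat n n" "B * A' = 1\<^sub>m n" "A' * B = 1\<^sub>m n"
    using det_non_zero_imp_unit[OF A', of "()"] unfolding Units_def ring_mat_def by auto
  define M where "M x y = (if x \<in> S \<and> y \<in> S then B $$ (g x, g y) else 0)" for x y
  have inj: "(g x = g y) = (x = y)" if "x \<in> S" "y \<in> S" for x y
    using g[OF that(1)] g[OF that(2)] by metis
  have "(\<Sum>k\<in>S. A x k * M k y) = of_bool (x = y)" if "x \<in> S" "y \<in> S" for x y
  proof -
    have "(\<Sum>k\<in>S. A x k * M k y) = (A' * B) $$ (g x, g y)"
      using g that B(1) gf by (simp add: sumS A'_def scalar_prod_def M_def)
    then show ?thesis using g that inj by (simp add: B(3))
  qed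
  moreover have "(\<Sum>k\<in>S. M x k * A k y) = of_bool (x = y)" if "x \<in> S" "y \<in> S" for x y
  proof -
    have "(\<Sum>k\<in>S. M x k * A k y) = (B * A') $$ (g x, g y)"
      using g that B(1) gf by (simp add: sumS A'_def scalar_prod_def M_def)
    then show ?thesis using g that inj by (simp add: B(2))
  qed
  ultimately have "is_inverse_on S A M"
    unfolding is_inverse_on_def by (auto simp: M_def)
  then show ?thesis by blast
qed

lemma is_inverse_on_matrix_inverse_on:
  assumes "finite S"
    and "\<And>u. (\<And>x. x \<in> S \<Longrightarrow> (\<Sum>k\<in>S. A x k * u k) = 0) \<Longrightarrow> \<forall>x\<in>S. u x = 0"
  shows "is_inverse_on S A (matrix_inverse_on S A)"
proof -
  obtain M where M: "is_inverse_on S A M"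
    using ex_inverse_on[OF assms] by blast
  have "is_inverse_on S A (THE M. is_inverse_on S A M)"
    using is_inverse_on_unique[OF assms(1) _ M] by (rule theI[of "is_inverse_on S A", OF M])
  then show ?thesis
    unfolding matrix_inverse_on_def is_inverse_on_def .
qed

lemma sum_of_bool_diff_mult:
  fixes u :: "'a \<Rightarrow> complex"
  assumes "finite S" "x \<in> S"
  shows "(\<Sum>k\<in>S. (of_bool (x = k) - z * Q x k) * u k) = u x - z * (\<Sum>k\<in>S. Q x k * u k)"
proof -
  have "(\<Sum>k\<in>S. (of_bool (x = k) - z * Q x k) * u k)
      = (\<Sum>k\<in>S. of_bool (x = k) * u k) - z * (\<Sum>k\<in>S. Q x k * u k)"
    by (simp add: left_diff_distrib sum_subtractf sum_distrib_left mult.assoc)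
  also have "(\<Sum>k\<in>S. of_bool (x = k) * u k) = u x"
    using assms by (rule sum_of_bool_eq_mult)
  finally show ?thesis .
qed

text \<open>The derivative of \<open>(I - zQ)^-1\<close> at 1 is \<open>M 1 * Q * M 1\<close>. The
  proof is a perturbation argument around 1. Since \<open>M z\<close> is a definite description,
  invertibility has to be extended from z = 1 to nearby z before anything can be said about
  it.\<close>

lemma resolvent_has_field_derivative:
  fixes S :: "'a set" and Q :: "'a \<Rightarrow> 'a \<Rightarrow> complex"
  defines "M \<equiv> \<lambda>z. matrix_inverse_on S (\<lambda>x y. of_bool (x = y) - z * Q x y)"
  assumes fin: "finite S"
    and ker: "\<And>u. (\<And>x. x \<in> S \<Longrightarrow> u x = (\<Sum>k\<in>S. Q x k * u k)) \<Longrightarrow> \<forall>x\<in>S. u x = 0"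
    and v: "v \<in> S"
  shows "((\<lambda>z. \<Sum>k\<in>S. M z v k * b k) has_field_derivative
      (\<Sum>k\<in>S. M 1 v k * (\<Sum>j\<in>S. Q k j * (\<Sum>i\<in>S. M 1 j i * b i)))) (at 1)"
proof -
  have inv1: "is_inverse_on S (\<lambda>x y. of_bool (x = y) - 1 * Q x y) (M 1)"
    unfolding M_def using sum_of_bool_diff_mult[OF fin, of _ 1 Q] ker
    by (intro is_inverse_on_matrix_inverse_on fin) (simp add: sum_of_bool_diff_mult[OF fin])
  \<comment> \<open>\<open>K\<close> is the matrix product of \<open>M 1\<close> and
    \<open>Q\<close>; \<open>c\<close> bounds its operator norm for the l1 norm \<open>N\<close>
    introduced below.\<close>
  define K where "K x j = (\<Sum>k\<in>S. M 1 x k * Q k j)" for x j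
  define c where "c = (\<Sum>x\<in>S. \<Sum>j\<in>S. cmod (K x j))"
  have c0: "c \<ge> 0" unfolding c_def by (intro sum_nonneg) auto
  have Kassoc: "(\<Sum>k\<in>S. M 1 x k * (\<Sum>j\<in>S. Q k j * u j)) = (\<Sum>j\<in>S. K x j * u j)" for x u
    unfolding K_def sum_distrib_left sum_distrib_right
    by (subst sum.swap) (simp add: mult.assoc)
  \<comment> \<open>Rewrite \<open>(I - zQ) u = a\<close> as
    \<open>(I - Q) u = a + (z - 1) Q u\<close> and apply \<open>M 1\<close>.\<close>
  have expand: "u x = (\<Sum>k\<in>S. M 1 x k * a k) + (z - 1) * (\<Sum>j\<in>S. K x j * u j)"
    if u: "\<And>x. x \<in> S \<Longrightarrow> u x - z * (\<Sum>k\<in>S. Q x k * u k) = a x" and x: "x \<in> S" for u z a x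
  proof -
    have "u x = (\<Sum>k\<in>S. M 1 x k * (a k + (z - 1) * (\<Sum>j\<in>S. Q k j * u j)))"
    proof (rule left_inverse_solve[OF fin _ _ x])
      show "\<forall>x\<in>S. \<forall>y\<in>S. (\<Sum>k\<in>S. M 1 x k * (of_bool (k = y) - 1 * Q k y)) = of_bool (x = y)"
        using inv1 unfolding is_inverse_on_def by simp
    next
      fix x assume "x \<in> S"
      then show "(\<Sum>k\<in>S. (of_bool (x = k) - 1 * Q x k) * u k)
          = a x + (z - 1) * (\<Sum>j\<in>S. Q x j * u j)"
        unfolding sum_of_bool_diff_mult[OF fin \<open>x \<in> S\<close>] using u[of x] by (simp add: algebra_simps)
    qed
    also have "\<dots> = (\<Sum>k\<in>S. M 1 x k * a k) + (z - 1) * (\<Sum>k\<in>S. M 1 x k * (\<Sum>j\<in>S. Q k j * u j))"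
      by (simp add: distrib_left sum.distrib sum_distrib_left mult.assoc mult.left_commute)
    finally show ?thesis unfolding Kassoc .
  qed
  define N :: "('a \<Rightarrow> complex) \<Rightarrow> real" where "N u = (\<Sum>x\<in>S. cmod (u x))" for u
  have N0: "N u \<ge> 0" for u unfolding N_def by (intro sum_nonneg) auto
  have leN: "cmod (u x) \<le> N u" if "x \<in> S" for u x
    unfolding N_def using fin that by (intro member_le_sum) auto
  have KN: "(\<Sum>x\<in>S. cmod (\<Sum>j\<in>S. K x j * u j)) \<le> c * N u" for u
  proof -
    have "cmod (\<Sum>j\<in>S. K x j * u j) \<le> (\<Sum>j\<in>S. cmod (K x j) * N u)" for x
      by (intro order_trans[OF norm_sum] sum_mono) (auto simp: norm_mult intro!: mult_left_mono leN)
    then have "(\<Sum>x\<in>S. cmod (\<Sum>j\<in>S. K x j * u j)) \<le> (\<Sum>x\<in>S. \<Sum>j\<in>S. cmod (K x j) * N u)"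
      by (intro sum_mono)
    then show ?thesis unfolding c_def by (simp add: sum_distrib_right)
  qed
  \<comment> \<open>For such z the term \<open>(z - 1) K u\<close> has at most half the norm of
    \<open>u\<close>; absorbing it on the left leaves the factor 2.\<close>
  have bound: "N u \<le> 2 * N (\<lambda>x. \<Sum>k\<in>S. M 1 x k * a k)"
    if "cmod (z - 1) * c \<le> 1/2" "\<And>x. x \<in> S \<Longrightarrow> u x - z * (\<Sum>k\<in>S. Q x k * u k) = a x" for u z a
  proof -
    have "N u = (\<Sum>x\<in>S. cmod ((\<Sum>k\<in>S. M 1 x k * a k) + (z - 1) * (\<Sum>j\<in>S. K x j * u j)))"
      unfolding N_def using expand[OF that(2)] by simp
    also have "\<dots> \<le> (\<Sum>x\<in>S. cmod (\<Sum>k\<in>S. M 1 x k * a k)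
        + cmod (z - 1) * cmod (\<Sum>j\<in>S. K x j * u j))"
      by (intro sum_mono order_trans[OF norm_triangle_ineq]) (simp add: norm_mult)
    also have "\<dots> = N (\<lambda>x. \<Sum>k\<in>S. M 1 x k * a k)
        + cmod (z - 1) * (\<Sum>x\<in>S. cmod (\<Sum>j\<in>S. K x j * u j))"
      by (simp add: N_def sum.distrib sum_distrib_left)
    also have "\<dots> \<le> N (\<lambda>x. \<Sum>k\<in>S. M 1 x k * a k) + cmod (z - 1) * (c * N u)"
      by (intro add_left_mono mult_left_mono KN) auto
    also have "\<dots> \<le> N (\<lambda>x. \<Sum>k\<in>S. M 1 x k * a k) + 1/2 * N u"
      using mult_right_mono[OF that(1) N0[of u]] by (simp add: mult.assoc)
    finally show ?thesis by simp
  qed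
  define U where "U z x = (\<Sum>k\<in>S. M z x k * b k)" for z x
  have near: "\<forall>\<^sub>F z in at 1. cmod (z - 1) * c \<le> 1/2"
  proof -
    have "((\<lambda>z. cmod (z - 1) * c) \<longlongrightarrow> cmod (1 - 1) * c) (at 1)"
      by (intro tendsto_intros)
    then have "\<forall>\<^sub>F z in at 1. cmod (z - 1) * c < 1/2"
      by (rule order_tendstoD) simp
    then show ?thesis by (rule eventually_mono) simp
  qed
  have U: "U z x - z * (\<Sum>k\<in>S. Q x k * U z k) = b x"
    if z: "cmod (z - 1) * c \<le> 1/2" and x: "x \<in> S" for z x
  proof -
    have inv: "is_inverse_on S (\<lambda>x y. of_bool (x = y) - z * Q x y) (M z)"
      unfolding M_def
    proof (intro is_inverse_on_matrix_inverse_on fin)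
      fix u assume "\<And>x. x \<in> S \<Longrightarrow> (\<Sum>k\<in>S. (of_bool (x = k) - z * Q x k) * u k) = 0"
      \<comment> \<open>With right-hand side 0 the bound forces \<open>u = 0\<close>, so
        \<open>I - zQ\<close> is invertible and \<open>M z\<close> really is its inverse.\<close>
      then have "N u \<le> 2 * N (\<lambda>x. \<Sum>k\<in>S. M 1 x k * (\<lambda>_. 0) k)"
        by (intro bound[OF z]) (simp add: sum_of_bool_diff_mult[OF fin])
      then have "N u = 0" using N0[of u] by (simp add: N_def)
      then show "\<forall>x\<in>S. u x = 0" using leN[of _ u] by auto
    qed
    have "U z x - z * (\<Sum>k\<in>S. Q x k * U z k)
        = (\<Sum>k\<in>S. (of_bool (x = k) - z * Q x k) * (\<Sum>j\<in>S. M z k j * b j))"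
      using sum_of_bool_diff_mult[OF fin x, of z Q "U z"] unfolding U_def by simp
    also have "\<dots> = (\<Sum>j\<in>S. (\<Sum>k\<in>S. (of_bool (x = k) - z * Q x k) * M z k j) * b j)"
      unfolding sum_distrib_left sum_distrib_right by (subst sum.swap) (simp add: mult.assoc)
    also have "\<dots> = (\<Sum>j\<in>S. of_bool (x = j) * b j)"
      using inv x unfolding is_inverse_on_def by simp
    also have "\<dots> = b x"
      using fin x by (rule sum_of_bool_eq_mult)
    finally show ?thesis .
  qed
  have diff: "U z x - U 1 x = (z - 1) * (\<Sum>j\<in>S. K x j * U z j)"
    if "cmod (z - 1) * c \<le> 1/2" "x \<in> S" for z x
    using expand[OF U, of z x] that unfolding U_def by simp
  have conv: "((\<lambda>z. U z x) \<longlongrightarrow> U 1 x) (at 1)" if x: "x \<in> S" for x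
  proof -
    have "\<forall>\<^sub>F z in at 1. cmod (U z x - U 1 x) \<le> cmod (z - 1) * (c * (2 * N (U 1)))"
      using near
    proof (rule eventually_mono)
      fix z assume z: "cmod (z - 1) * c \<le> 1/2"
      have "cmod (\<Sum>j\<in>S. K x j * U z j) \<le> (\<Sum>x\<in>S. cmod (\<Sum>j\<in>S. K x j * U z j))"
        using fin x by (intro member_le_sum) auto
      also have "\<dots> \<le> c * N (U z)" by (rule KN)
      also have "\<dots> \<le> c * (2 * N (U 1))"
        using bound[OF z U[OF z]] c0 unfolding U_def by (intro mult_left_mono) auto
      finally show "cmod (U z x - U 1 x) \<le> cmod (z - 1) * (c * (2 * N (U 1)))"
        unfolding diff[OF z x] norm_mult by (intro mult_left_mono) auto
    qed
    moreover have "((\<lambda>z::complex. cmod (z - 1) * (c * (2 * N (U 1)))) \<longlongrightarrow> 0) (at 1)"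
    proof -
      have "((\<lambda>z::complex. cmod (z - 1) * (c * (2 * N (U 1))))
          \<longlongrightarrow> cmod (1 - 1) * (c * (2 * N (U 1)))) (at 1)"
        by (intro tendsto_intros)
      then show ?thesis by simp
    qed
    ultimately have "((\<lambda>z. U z x - U 1 x) \<longlongrightarrow> 0) (at 1)"
      by (rule Lim_null_comparison)
    then show ?thesis by (rule LIM_zero_cancel)
  qed
  \<comment> \<open>By \<open>diff\<close> the difference quotient is exactly \<open>K\<close>
    applied to \<open>U z\<close>, so continuity of \<open>U\<close> at 1 is enough.\<close>
  have "((\<lambda>z. (U z v - U 1 v) / (z - 1)) \<longlongrightarrow> (\<Sum>j\<in>S. K v j * U 1 j)) (at 1)"
  proof (rule Lim_transform_eventually)
    show "((\<lambda>z. \<Sum>j\<in>S. K v j * U z j) \<longlongrightarrow> (\<Sum>j\<in>S. K v j * U 1 j)) (at 1)"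
      by (intro tendsto_intros conv)
    show "\<forall>\<^sub>F z in at 1. (\<Sum>j\<in>S. K v j * U z j) = (U z v - U 1 v) / (z - 1)"
      using near eventually_neq_at_within[of 1]
      by eventually_elim (simp add: diff v)
  qed
  then show ?thesis
    unfolding has_field_derivative_iff Kassoc U_def .
qed

section \<open>Hitting times on finite graphs\<close>

text \<open>The unnormalised form, degree matrix minus adjacency matrix. It is symmetric, which
  makes its values sum to zero over a finite graph.\<close>

definition laplacian :: "'a graph \<Rightarrow> ('a \<Rightarrow> complex) \<Rightarrow> 'a \<Rightarrow> complex" where
  "laplacian G u x = of_nat (degree G x) * u x - (\<Sum>y\<in>neighbours G x. u y)"

text \<open>Off \<open>w\<close> this is the first-step equation "1 plus the mean over the
  neighbours", multiplied by the degree. A Dirichlet problem thus stands in for the expected hitting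
  time, without a probability space.\<close>

definition hitting_time :: "'a graph \<Rightarrow> 'a \<Rightarrow> ('a \<Rightarrow> complex) \<Rightarrow> bool" where
  "hitting_time G w u \<longleftrightarrow> u w = 0 \<and> (\<forall>x\<in>verts G - {w}. laplacian G u x = of_nat (degree G x))"

definition total_degree :: "'a graph \<Rightarrow> nat" where
  "total_degree G = (\<Sum>x\<in>verts G. degree G x)"

section \<open>Graph isomorphisms, degrees and the Laplacian\<close>

lemma adj_commute: "adj G x y \<longleftrightarrow> adj G y x"
  by (simp add: adj_def insert_commute)

lemma adj_verts:
  assumes "simple_graph G" "adj G x y"
  shows "x \<in> verts G" "y \<in> verts G" "x \<noteq> y"
  using assms unfolding simple_graph_def adj_def by (fastforce simp: doubleton_eq_iff)+

lemma neighbours_subset: "simple_graph G \<Longrightarrow> neighbours G x \<subseteq> verts G"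
  using adj_verts by (fastforce simp: neighbours_def)

lemma graph_iso_neighbours:
  assumes "simple_graph G" "simple_graph G'" "graph_iso \<alpha> G G'" "x \<in> verts G"
  shows "neighbours G' (\<alpha> x) = \<alpha> ` neighbours G x"
proof (intro Set.set_eqI iffI)
  fix y assume y: "y \<in> neighbours G' (\<alpha> x)"
  then have "y \<in> \<alpha> ` verts G"
    using neighbours_subset[OF assms(2)] assms(3) by (auto simp: graph_iso_def bij_betw_def)
  then show "y \<in> \<alpha> ` neighbours G x"
    using y assms(3,4) by (auto simp: graph_iso_def neighbours_def)
next
  fix y assume "y \<in> \<alpha> ` neighbours G x"
  then show "y \<in> neighbours G' (\<alpha> x)"
    using neighbours_subset[OF assms(1), of x] assms(3,4) by (auto simp: graph_iso_def neighbours_def)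
qed

lemma graph_iso_inj_on_neighbours:
  assumes "simple_graph G" "graph_iso \<alpha> G G'"
  shows "inj_on \<alpha> (neighbours G x)"
  using assms neighbours_subset[OF assms(1), of x] unfolding graph_iso_def bij_betw_def
  by (meson inj_on_subset)

lemma graph_iso_degree:
  assumes "simple_graph G" "simple_graph G'" "graph_iso \<alpha> G G'" "x \<in> verts G"
  shows "degree G' (\<alpha> x) = degree G x"
  unfolding degree_def graph_iso_neighbours[OF assms]
  by (rule card_image[OF graph_iso_inj_on_neighbours[OF assms(1,3)]])

lemma graph_iso_total_degree:
  assumes "simple_graph G" "simple_graph G'" "graph_iso \<alpha> G G'"
  shows "total_degree G' = total_degree G"
proof -
  have "bij_betw \<alpha> (verts G) (verts G')" using assms(3) by (simp add: graph_iso_def)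
  then have "total_degree G' = (\<Sum>x\<in>verts G. degree G' (\<alpha> x))"
    unfolding total_degree_def by (rule sum.reindex_bij_betw[symmetric])
  then show ?thesis unfolding total_degree_def using graph_iso_degree[OF assms] by simp
qed

lemma graph_iso_laplacian:
  assumes "simple_graph G" "simple_graph G'" "graph_iso \<alpha> G G'" "x \<in> verts G"
  shows "laplacian G' u (\<alpha> x) = laplacian G (u \<circ> \<alpha>) x"
  unfolding laplacian_def graph_iso_degree[OF assms]
  unfolding graph_iso_neighbours[OF assms]
    sum.reindex[OF graph_iso_inj_on_neighbours[OF assms(1,3)]]
  by simp

lemma graph_iso_trans:
  assumes "graph_iso \<alpha> G H" "graph_iso \<beta> H K"
  shows "graph_iso (\<beta> \<circ> \<alpha>) G K"
  using assms unfolding graph_iso_def by (auto intro: bij_betw_trans dest: bij_betwE)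

section \<open>Maximum principle and uniqueness of hitting times\<close>

locale finite_connected_graph =
  fixes G :: "'a graph"
  assumes simple: "simple_graph G"
    and conn: "connected_graph G"
    and fin: "finite (verts G)"
begin

lemma finite_neighbours: "finite (neighbours G x)"
  using neighbours_subset[OF simple] fin finite_subset by blast

text \<open>The second vertex excludes the one-vertex graph, which is connected but has degree
  0.\<close>

lemma degree_pos:
  assumes "x \<in> verts G" "y \<in> verts G" "x \<noteq> y"
  shows "degree G x > 0"
proof -
  have "(adj G)\<^sup>*\<^sup>* x y" using conn assms unfolding connected_graph_def by blast
  then obtain z where "adj G x z" using assms(3) by (metis converse_rtranclpE)
  then show ?thesis
    using finite_neighbours[of x] unfolding degree_def neighbours_def by (auto simp: card_gt_0_iff)
qed

text \<open>Where the modulus is maximal, the mean value property forces the same modulus on all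
  neighbours. Connectedness carries the maximum to \<open>b\<close>, where \<open>u\<close> is
  0.\<close>

lemma max_principle:
  assumes B: "b \<in> B" "b \<in> verts G" "\<And>x. x \<in> B \<Longrightarrow> u x = 0"
    and harm: "\<And>x. x \<in> verts G - B \<Longrightarrow> laplacian G u x = 0"
    and x: "x \<in> verts G"
  shows "u x = 0"
proof -
  define m where "m = Max ((\<lambda>y. cmod (u y)) ` verts G)"
  have le: "cmod (u y) \<le> m" if "y \<in> verts G" for y
    unfolding m_def using fin that by auto
  have "m \<in> (\<lambda>y. cmod (u y)) ` verts G"
    unfolding m_def using fin x by (intro Max_in) auto
  then obtain p where p: "p \<in> verts G" "cmod (u p) = m" by auto
  \<comment> \<open>The alternative \<open>m = 0\<close> covers vertices \<open>y\<close> in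
    \<open>B\<close>: there \<open>u y = 0\<close>, so the maximum itself is 0.\<close>
  have attained: "cmod (u z) = m \<or> m = 0" if y: "y \<in> verts G" "cmod (u y) = m" and yz: "adj G y z" for y z
  proof (cases "y \<in> B")
    case True
    then show ?thesis using y B(3) by simp
  next
    case False
    have z: "z \<in> neighbours G y" "z \<in> verts G"
      using yz adj_verts[OF simple yz] by (auto simp: neighbours_def)
    have "of_nat (degree G y) * u y = (\<Sum>y\<in>neighbours G y. u y)"
      using harm[of y] False y by (simp add: laplacian_def)
    then have "real (degree G y) * m = cmod (\<Sum>y\<in>neighbours G y. u y)"
      using y(2) by (metis norm_mult norm_of_nat)
    also have "\<dots> \<le> (\<Sum>y\<in>neighbours G y. cmod (u y))" by (rule norm_sum)
    also have "\<dots> = cmod (u z) + (\<Sum>y\<in>neighbours G y - {z}. cmod (u y))"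
      using finite_neighbours z by (simp add: sum.remove)
    also have "\<dots> \<le> cmod (u z) + (\<Sum>y\<in>neighbours G y - {z}. m)"
      using neighbours_subset[OF simple, of y] by (intro add_left_mono sum_mono le) auto
    also have "\<dots> = cmod (u z) + (real (degree G y) - 1) * m"
    proof -
      have "card (neighbours G y) > 0" using z finite_neighbours by (auto simp: card_gt_0_iff)
      then show ?thesis using z finite_neighbours by (simp add: degree_def card_Diff_singleton)
    qed
    finally have "m \<le> cmod (u z)" by (simp add: algebra_simps)
    then show ?thesis using le[OF z(2)] by simp
  qed
  have "(adj G)\<^sup>*\<^sup>* p b" using conn p B unfolding connected_graph_def by blast
  then have "b \<in> verts G \<and> (cmod (u b) = m \<or> m = 0)"
  proof (induction rule: rtranclp_induct)
    case base
    then show ?case using p by simp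
  next
    case (step y z)
    then show ?case using attained[of y z] adj_verts[OF simple step(2)] by blast
  qed
  then have "m = 0" using B(1,3) by simp
  then show ?thesis using le[OF x] by simp
qed

text \<open>Double counting: by symmetry of adjacency each \<open>u y\<close> occurs
  \<open>degree G y\<close> times in the sum over neighbours.\<close>

lemma sum_laplacian: "(\<Sum>x\<in>verts G. laplacian G u x) = 0"
proof -
  have "(\<Sum>x\<in>verts G. \<Sum>y\<in>neighbours G x. u y) = (\<Sum>x\<in>verts G. \<Sum>y\<in>{y\<in>verts G. adj G x y}. u y)"
    using adj_verts[OF simple] by (intro sum.cong) (auto simp: neighbours_def)
  also have "\<dots> = (\<Sum>y\<in>verts G. \<Sum>x\<in>{x\<in>verts G. adj G x y}. u y)"
    using fin by (intro sum.swap_restrict) auto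
  also have "\<dots> = (\<Sum>y\<in>verts G. of_nat (degree G y) * u y)"
  proof (rule sum.cong)
    fix y
    have "{x \<in> verts G. adj G x y} = neighbours G y"
      using adj_verts[OF simple] by (auto simp: neighbours_def adj_commute)
    then show "(\<Sum>x\<in>{x\<in>verts G. adj G x y}. u y) = of_nat (degree G y) * u y"
      by (simp add: degree_def)
  qed simp
  finally show ?thesis by (simp add: laplacian_def sum_subtractf)
qed

text \<open>The definition of \<open>hitting_time\<close> prescribes no Laplacian at the target;
  \<open>sum_laplacian\<close> determines it from the values elsewhere.\<close>

lemma hitting_time_laplacian_target:
  assumes "hitting_time G w u" "w \<in> verts G"
  shows "laplacian G u w = of_nat (degree G w) - of_nat (total_degree G)"
proof -
  have "0 = laplacian G u w + (\<Sum>x\<in>verts G - {w}. laplacian G u x)"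
    using sum_laplacian[of u] sum.remove[OF fin assms(2), of "laplacian G u"] by simp
  also have "(\<Sum>x\<in>verts G - {w}. laplacian G u x) = (\<Sum>x\<in>verts G - {w}. of_nat (degree G x))"
    using assms(1) by (intro sum.cong) (auto simp: hitting_time_def)
  also have "\<dots> = of_nat (total_degree G) - of_nat (degree G w)"
    unfolding total_degree_def using sum.remove[OF fin assms(2), of "degree G"] by simp
  finally show ?thesis by (simp add: algebra_simps)
qed

lemma laplacian_diff: "laplacian G (\<lambda>y. u y - u' y) x = laplacian G u x - laplacian G u' x"
  by (simp add: laplacian_def sum_subtractf algebra_simps)

lemma laplacian_add: "laplacian G (\<lambda>y. u y + u' y) x = laplacian G u x + laplacian G u' x"
  by (simp add: laplacian_def sum.distrib algebra_simps)

lemma laplacian_cmult: "laplacian G (\<lambda>y. c * u y) x = c * laplacian G u x"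
  by (simp add: laplacian_def sum_distrib_left algebra_simps)

lemma laplacian_const: "laplacian G (\<lambda>y. c) x = 0"
  by (simp add: laplacian_def degree_def)

lemma laplacian_sum: "laplacian G (\<lambda>y. \<Sum>w\<in>W. h w y) x = (\<Sum>w\<in>W. laplacian G (h w) x)"
proof -
  have "(\<Sum>y\<in>neighbours G x. \<Sum>w\<in>W. h w y) = (\<Sum>w\<in>W. \<Sum>y\<in>neighbours G x. h w y)"
    by (rule sum.swap)
  then show ?thesis by (simp add: laplacian_def sum_subtractf sum_distrib_left)
qed

lemmas laplacian_linear = laplacian_diff laplacian_add laplacian_cmult laplacian_const laplacian_sum

lemma hitting_time_unique:
  assumes "hitting_time G w u" "hitting_time G w u'" "w \<in> verts G" "x \<in> verts G"
  shows "u x = u' x"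
proof -
  have "u x - u' x = 0"
    by (rule max_principle[of w "{w}"])
      (use assms in \<open>auto simp: hitting_time_def laplacian_diff\<close>)
  then show ?thesis by simp
qed

section \<open>Green function of the walk absorbed in a set\<close>

definition walk_matrix :: "'a set \<Rightarrow> 'a \<Rightarrow> 'a \<Rightarrow> complex" where
  "walk_matrix B x y = (if x \<in> verts G - B \<and> adj G x y then 1 / of_nat (degree G x) else 0)"

lemma walk_matrix_sum:
  "(\<Sum>y\<in>verts G. walk_matrix B x y * u y) =
    (if x \<in> verts G - B then (\<Sum>y\<in>neighbours G x. u y) / of_nat (degree G x) else 0)"
proof (cases "x \<in> verts G - B")
  case True
  have "(\<Sum>y\<in>verts G. walk_matrix B x y * u y) = (\<Sum>y\<in>neighbours G x. walk_matrix B x y * u y)"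
    using neighbours_subset[OF simple] fin
    by (intro sum.mono_neutral_right) (auto simp: walk_matrix_def neighbours_def)
  also have "\<dots> = (\<Sum>y\<in>neighbours G x. u y / of_nat (degree G x))"
    using True by (intro sum.cong) (auto simp: walk_matrix_def neighbours_def)
  finally show ?thesis using True by (simp add: sum_divide_distrib)
qed (auto simp: walk_matrix_def)

text \<open>Translates linear systems for \<open>I - Q\<close> at z = 1 into Dirichlet
  problems.\<close>

lemma walk_matrix_laplacian:
  assumes "x \<in> verts G - B" "degree G x > 0"
  shows "u x - (\<Sum>y\<in>verts G. walk_matrix B x y * u y) = laplacian G u x / of_nat (degree G x)"
  unfolding walk_matrix_sum laplacian_def using assms by (simp add: diff_divide_distrib)

context
  fixes B b
  assumes B: "b \<in> B" "B \<subseteq> verts G" and ex: "\<exists>a\<in>verts G. a \<noteq> b"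
begin

lemma deg_pos: "x \<in> verts G \<Longrightarrow> degree G x > 0"
  using degree_pos[of x] B ex by (metis subsetD)

text \<open>The rows of \<open>walk_matrix B\<close> in \<open>B\<close> are zero, so
  \<open>u\<close> vanishes on \<open>B\<close>; off \<open>B\<close> it is harmonic and the maximum
  principle applies.\<close>

lemma walk_matrix_kernel:
  assumes "\<And>x. x \<in> verts G \<Longrightarrow> u x = (\<Sum>k\<in>verts G. walk_matrix B x k * u k)"
  shows "\<forall>x\<in>verts G. u x = 0"
proof
  fix x assume x: "x \<in> verts G"
  show "u x = 0"
  proof (rule max_principle[OF B(1) _ _ _ x])
    show "b \<in> verts G" using B by blast
  next
    fix y assume "y \<in> B"
    then show "u y = 0" using assms[of y] B by (auto simp: walk_matrix_sum)
  next
    fix y assume y: "y \<in> verts G - B"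
    then show "laplacian G u y = 0"
      using walk_matrix_laplacian[OF y deg_pos, of u] assms[of y] deg_pos[of y] by simp
  qed
qed

definition green :: "complex \<Rightarrow> 'a \<Rightarrow> 'a \<Rightarrow> complex" where
  "green z = matrix_inverse_on (verts G) (\<lambda>x y. of_bool (x = y) - z * walk_matrix B x y)"

lemma green_inverse:
  "is_inverse_on (verts G) (\<lambda>x y. of_bool (x = y) - 1 * walk_matrix B x y) (green 1)"
  unfolding green_def
  using walk_matrix_kernel
  by (intro is_inverse_on_matrix_inverse_on fin) (simp add: sum_of_bool_diff_mult[OF fin, where z = 1, simplified])

text \<open>The single function \<open>r\<close> carries both the boundary values on
  \<open>B\<close> and the source term off \<open>B\<close>, because the rows of
  \<open>I - Q\<close> in \<open>B\<close> are unit rows. Values of \<open>green 1\<close> are found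
  by guessing such a \<open>u\<close>.\<close>

lemma green_solve:
  assumes "\<And>x. x \<in> B \<Longrightarrow> u x = r x"
    and "\<And>x. x \<in> verts G - B \<Longrightarrow> laplacian G u x = of_nat (degree G x) * r x"
    and "x \<in> verts G"
  shows "(\<Sum>k\<in>verts G. green 1 x k * r k) = u x"
proof (rule left_inverse_solve[OF fin _ _ assms(3), symmetric])
  show "\<forall>x\<in>verts G. \<forall>y\<in>verts G.
      (\<Sum>k\<in>verts G. green 1 x k * (of_bool (k = y) - 1 * walk_matrix B k y)) = of_bool (x = y)"
    using green_inverse unfolding is_inverse_on_def by blast
next
  fix x assume x: "x \<in> verts G"
  show "(\<Sum>k\<in>verts G. (of_bool (x = k) - 1 * walk_matrix B x k) * u k) = r x"
  proof (cases "x \<in> B")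
    case True
    then show ?thesis
      unfolding sum_of_bool_diff_mult[OF fin x] using assms(1) by (simp add: walk_matrix_sum)
  next
    case False
    then show ?thesis
      unfolding sum_of_bool_diff_mult[OF fin x]
      using walk_matrix_laplacian[of x B u] assms(2)[of x] deg_pos[OF x] x by simp
  qed
qed

text \<open>Here the right inverse is used: the sum of the Green function against \<open>r\<close>
  is itself a solution.\<close>

lemma ex_solution:
  "\<exists>u. (\<forall>x\<in>B. u x = r x) \<and> (\<forall>x\<in>verts G - B. laplacian G u x = of_nat (degree G x) * r x)"
proof -
  define u where "u x = (\<Sum>k\<in>verts G. green 1 x k * r k)" for x
  have eq: "u x - (\<Sum>k\<in>verts G. walk_matrix B x k * u k) = r x" if x: "x \<in> verts G" for x
  proof -
    have "u x - 1 * (\<Sum>k\<in>verts G. walk_matrix B x k * u k)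
        = (\<Sum>k\<in>verts G. (of_bool (x = k) - 1 * walk_matrix B x k) * (\<Sum>j\<in>verts G. green 1 k j * r j))"
      using sum_of_bool_diff_mult[OF fin x, of 1 "walk_matrix B" u] unfolding u_def by simp
    also have "\<dots> = (\<Sum>j\<in>verts G. (\<Sum>k\<in>verts G. (of_bool (x = k) - 1 * walk_matrix B x k) * green 1 k j) * r j)"
      unfolding sum_distrib_left sum_distrib_right by (subst sum.swap) (simp add: mult.assoc)
    also have "\<dots> = (\<Sum>j\<in>verts G. of_bool (x = j) * r j)"
      using green_inverse x unfolding is_inverse_on_def by simp
    also have "\<dots> = r x"
      using fin x by (rule sum_of_bool_eq_mult)
    finally show ?thesis by simp
  qed
  have "u x = r x" if "x \<in> B" for x
    using eq[of x] B that by (auto simp: walk_matrix_sum)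
  moreover have "laplacian G u x = of_nat (degree G x) * r x" if x: "x \<in> verts G - B" for x
    using walk_matrix_laplacian[OF x, of u] eq[of x] deg_pos[of x] x by (simp add: field_simps)
  ultimately show ?thesis by blast
qed

text \<open>The derivative of the resolvent \<open>G\<close> at 1 is \<open>G Q G\<close>, applied
  here to the indicator of \<open>B\<close>. The first \<open>G\<close> produces the constant 1
  (absorption is certain), \<open>Q\<close> turns it into the indicator of the complement of
  \<open>B\<close>, and the second \<open>G\<close> gives the mean absorption time
  \<open>e\<close>.\<close>

lemma deriv_absorption:
  assumes v: "v \<in> verts G"
    and e: "\<And>x. x \<in> B \<Longrightarrow> e x = 0"
      "\<And>x. x \<in> verts G - B \<Longrightarrow> laplacian G e x = of_nat (degree G x)"
  shows "deriv (\<lambda>z. \<Sum>w\<in>B. green z v w) 1 = e v"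
proof -
  define r :: "'a \<Rightarrow> complex" where "r x = of_bool (x \<in> B)" for x
  have one: "(\<Sum>k\<in>verts G. green 1 x k * r k) = 1" if "x \<in> verts G" for x
    by (rule green_solve[OF _ _ that, of "\<lambda>_. 1"]) (auto simp: r_def laplacian_const)
  have inner: "(\<Sum>j\<in>verts G. walk_matrix B k j * (\<Sum>i\<in>verts G. green 1 j i * r i)) = of_bool (k \<notin> B)"
    if k: "k \<in> verts G" for k
  proof -
    have "(\<Sum>j\<in>verts G. walk_matrix B k j * (\<Sum>i\<in>verts G. green 1 j i * r i))
        = (\<Sum>j\<in>verts G. walk_matrix B k j * (\<lambda>_. 1) j)"
      using one by simp
    also have "\<dots> = of_bool (k \<notin> B)"
      unfolding walk_matrix_sum using k deg_pos[OF k] by (simp add: degree_def)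
    finally show ?thesis .
  qed
  have "((\<lambda>z. \<Sum>k\<in>verts G. green z v k * r k) has_field_derivative
      (\<Sum>k\<in>verts G. green 1 v k * (\<Sum>j\<in>verts G. walk_matrix B k j *
        (\<Sum>i\<in>verts G. green 1 j i * r i)))) (at 1)"
    unfolding green_def
    by (rule resolvent_has_field_derivative[OF fin walk_matrix_kernel v])
  also have "(\<Sum>k\<in>verts G. green 1 v k * (\<Sum>j\<in>verts G. walk_matrix B k j *
        (\<Sum>i\<in>verts G. green 1 j i * r i))) = (\<Sum>k\<in>verts G. green 1 v k * of_bool (k \<notin> B))"
    using inner by simp
  also have "\<dots> = e v"
    by (rule green_solve[OF _ _ v]) (auto simp: e)
  also have "(\<lambda>z. \<Sum>k\<in>verts G. green z v k * r k) = (\<lambda>z. \<Sum>w\<in>B. green z v w)"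
  proof
    fix z
    have "(\<Sum>k\<in>verts G. green z v k * r k) = (\<Sum>k\<in>B. green z v k * r k)"
      using B fin by (intro sum.mono_neutral_right) (auto simp: r_def)
    then show "(\<Sum>k\<in>verts G. green z v k * r k) = (\<Sum>w\<in>B. green z v w)"
      by (simp add: r_def)
  qed
  finally show ?thesis by (rule DERIV_imp_deriv)
qed

text \<open>The instance of \<open>green_solve\<close> in which \<open>r\<close> is the indicator of
  \<open>v\<close>.\<close>

lemma green_at_1:
  assumes v: "v \<in> verts G - B"
    and g: "\<And>x. x \<in> B \<Longrightarrow> g x = 0"
      "\<And>x. x \<in> verts G - B \<Longrightarrow> x \<noteq> v \<Longrightarrow> laplacian G g x = 0"
      "laplacian G g v = of_nat (degree G v)"
  shows "green 1 v v = g v"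
proof -
  have "(\<Sum>k\<in>verts G. green 1 v k * of_bool (k = v)) = g v"
    by (rule green_solve) (use v g in auto)
  moreover have "(\<Sum>k\<in>verts G. green 1 v k * of_bool (k = v)) = green 1 v v"
    using sum_of_bool_eq_mult[OF fin, of v "green 1 v"] v by (simp add: mult.commute eq_commute)
  ultimately show ?thesis by simp
qed

end

lemma ex_hitting_time:
  assumes "w \<in> verts G" "a \<in> verts G" "a \<noteq> w"
  shows "\<exists>u. hitting_time G w u"
proof -
  obtain u where u: "\<forall>x\<in>{w}. u x = of_bool (x \<noteq> w)"
    "\<forall>x\<in>verts G - {w}. laplacian G u x = of_nat (degree G x) * of_bool (x \<noteq> w)"
    using ex_solution[of w "{w}" "\<lambda>x. of_bool (x \<noteq> w)"] assms by auto
  then have "hitting_time G w u" by (auto simp: hitting_time_def)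
  then show ?thesis by blast
qed

text \<open>If the expected hitting times between the vertices of \<open>W\<close> have a common value \<open>h\<close>, then the
  potentials with sources in \<open>W\<close> are explicit linear combinations of the hitting time functions.\<close>

lemma equidistant_hitting_times:
  assumes W: "W \<subseteq> verts G" "card W \<ge> 2" and v: "v \<in> W"
    and h: "\<And>w u x. w \<in> W \<Longrightarrow> hitting_time G w u \<Longrightarrow> x \<in> W \<Longrightarrow> x \<noteq> w \<Longrightarrow> u x = h"
  defines "M \<equiv> \<lambda>z. matrix_inverse_on (verts G) (\<lambda>x y. of_bool (x = y) - z * walk_matrix (W - {v}) x y)"
  shows "deriv (\<lambda>z. \<Sum>w\<in>W - {v}. M z v w) 1 = h / (of_nat (card W) - 1)"
    and "M 1 v v = of_nat (degree G v) * of_nat (card W) * h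
      / ((of_nat (card W) - 1) * of_nat (total_degree G))"
proof -
  define t :: complex where "t = of_nat (card W)"
  define m :: complex where "m = of_nat (total_degree G)"
  have finW: "finite W" using W(1) fin finite_subset by blast
  define B where "B = W - {v}"
  have cB: "card B = card W - 1" using v finW by (simp add: B_def)
  then have "card B > 0" using W(2) by simp
  then obtain b where b: "b \<in> B" by (auto simp: card_gt_0_iff)
  have BV: "B \<subseteq> verts G" and finB: "finite B" and vV: "v \<in> verts G - B"
    using W v finW by (auto simp: B_def)
  have ex: "\<exists>a\<in>verts G. a \<noteq> b" using v W b by (auto simp: B_def)
  have t: "of_nat (card B) = t - 1" "t \<noteq> 1"
  proof -
    have *: "card W = Suc (card B)" using cB W(2) by simp
    show "of_nat (card B) = t - 1" unfolding t_def * by simp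
    show "t \<noteq> 1" using W(2) unfolding t_def by (metis Suc_1 not_less_eq_eq of_nat_1_eq_iff order_refl One_nat_def)
  qed
  have "degree G v > 0" using degree_pos[of v b] vV b BV by auto
  then have "total_degree G > 0"
    unfolding total_degree_def using vV fin by (auto simp: sum_pos2 intro: sum_pos2[of _ v])
  then have m0: "m \<noteq> 0" by (simp add: m_def)
  have "\<forall>w\<in>W. \<exists>u. hitting_time G w u"
    using ex_hitting_time W b v BV by (metis DiffD1 DiffD2 B_def singletonI subsetD)
  then obtain H where H: "\<And>w. w \<in> W \<Longrightarrow> hitting_time G w (H w)" by metis
  have HW: "H w x = (if x = w then 0 else h)" if "w \<in> W" "x \<in> W" for w x
    using h[OF that(1) H[OF that(1)] that(2)] H[OF that(1)] by (auto simp: hitting_time_def)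
  \<comment> \<open>Up to one pole of mass \<open>m\<close> at \<open>w\<close>, each
    \<open>H w\<close> has the degree as its Laplacian; the combinations \<open>e\<close> and
    \<open>g\<close> below are designed by balancing these poles.\<close>
  have LH: "laplacian G (H w) x = of_nat (degree G x) - (if x = w then m else 0)"
    if "w \<in> W" "x \<in> verts G" for w x
    using H[OF that(1)] hitting_time_laplacian_target[OF H[OF that(1)]] that
    by (auto simp: hitting_time_def m_def)
  \<comment> \<open>Of the \<open>t - 1\<close> summands the one with \<open>w = x\<close> vanishes,
    which leaves \<open>t - 2\<close>.\<close>
  have SB: "(\<Sum>w\<in>B. H w x) = (t - 2) * h" if x: "x \<in> B" for x
  proof -
    have "(\<Sum>w\<in>B. H w x) = (\<Sum>w\<in>B. h - (if x = w then h else 0))"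
      using x by (intro sum.cong) (auto simp: HW B_def)
    also have "\<dots> = (t - 2) * h" using x finB by (simp add: sum_subtractf t algebra_simps)
    finally show ?thesis .
  qed
  have Sv: "(\<Sum>w\<in>B. H w v) = (t - 1) * h"
  proof -
    have "(\<Sum>w\<in>B. H w v) = (\<Sum>w\<in>B. h)"
      using v by (intro sum.cong) (auto simp: HW B_def)
    then show ?thesis by (simp add: t)
  qed
  have LS: "(\<Sum>w\<in>B. laplacian G (H w) x) = (t - 1) * of_nat (degree G x)" if "x \<in> verts G - B" for x
  proof -
    have "(\<Sum>w\<in>B. laplacian G (H w) x) = (\<Sum>w\<in>B. of_nat (degree G x))"
      using that by (intro sum.cong) (auto simp: LH B_def)
    then show ?thesis by (simp add: t)
  qed
  have M: "M = green B"
    unfolding M_def B_def[symmetric] green_def[OF b BV ex] by simp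
  \<comment> \<open>Subtracting the constant value of the sum on \<open>B\<close> makes
    \<open>e\<close> vanish there; dividing by \<open>t - 1\<close>, the size of \<open>B\<close>,
    normalises the Laplacian off \<open>B\<close>.\<close>
  define e where "e x = 1 / (t - 1) * ((\<Sum>w\<in>B. H w x) - (t - 2) * h)" for x
  have "deriv (\<lambda>z. \<Sum>w\<in>B. green B z v w) 1 = e v"
  proof (rule deriv_absorption[OF b BV ex])
    show "v \<in> verts G" using vV by simp
    show "e x = 0" if "x \<in> B" for x using SB[OF that] by (simp add: e_def)
    show "laplacian G e x = of_nat (degree G x)" if "x \<in> verts G - B" for x
      unfolding e_def laplacian_linear using LS[OF that] t by simp
  qed
  then show "deriv (\<lambda>z. \<Sum>w\<in>W - {v}. M z v w) 1 = h / (of_nat (card W) - 1)"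
    unfolding M B_def[symmetric] t_def[symmetric] by (simp add: e_def Sv algebra_simps)
  \<comment> \<open>In \<open>g\<close> below, subtracting \<open>(t - 1) * H v\<close> cancels the
    degrees and leaves, off \<open>B\<close>, only a pole of mass \<open>(t - 1) * m\<close> at
    \<open>v\<close>, which \<open>c\<close> scales to \<open>degree G v\<close>. Adding
    \<open>h\<close> gives zero on \<open>B\<close>, as
    \<open>(t - 2) * h - (t - 1) * h + h = 0\<close>.\<close>
  define c where "c = of_nat (degree G v) / ((t - 1) * m)"
  define g where "g x = c * ((\<Sum>w\<in>B. H w x) - (t - 1) * H v x + h)" for x
  have "green B 1 v v = g v"
  proof (rule green_at_1[OF b BV ex vV])
    show "g x = 0" if "x \<in> B" for x
      using SB[OF that] that v by (auto simp: g_def HW B_def algebra_simps)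
    show "laplacian G g x = 0" if "x \<in> verts G - B" "x \<noteq> v" for x
      unfolding g_def laplacian_linear using LS[OF that(1)] LH[of v x] that v by simp
    show "laplacian G g v = of_nat (degree G v)"
    proof -
      have Lv: "laplacian G (H v) v = of_nat (degree G v) - m" using LH[of v v] vV v by simp
      have "laplacian G g v = c * ((t - 1) * m)"
        unfolding g_def laplacian_linear LS[OF vV] Lv by (simp add: algebra_simps)
      then show ?thesis using t m0 by (simp add: c_def)
    qed
  qed
  then show "M 1 v v = of_nat (degree G v) * of_nat (card W) * h
      / ((of_nat (card W) - 1) * of_nat (total_degree G))"
    unfolding M t_def[symmetric] m_def[symmetric]
    using Sv v by (simp add: g_def c_def HW algebra_simps)
qed

end

text \<open>The pullback of \<open>u'\<close> along \<alpha> solves the Dirichlet problem for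
  \<open>w\<close>, and uniqueness applies. The problem distinguishes only the target, so \<alpha>
  may move all other vertices freely.\<close>

lemma graph_iso_hitting_time:
  assumes G: "finite_connected_graph G" "simple_graph G'" "graph_iso \<alpha> G G'"
    and w: "w \<in> verts G" "x \<in> verts G" and u: "hitting_time G w u" "hitting_time G' (\<alpha> w) u'"
  shows "u' (\<alpha> x) = u x"
proof -
  interpret finite_connected_graph G by (rule G)
  have bij: "inj_on \<alpha> (verts G)" "\<alpha> ` verts G = verts G'"
    using G(3) by (auto simp: graph_iso_def bij_betw_def)
  have "laplacian G (u' \<circ> \<alpha>) y = of_nat (degree G y)" if y: "y \<in> verts G" "y \<noteq> w" for y
  proof -
    have "\<alpha> y \<in> verts G'" "\<alpha> y \<noteq> \<alpha> w"
      using bij y w(1) by (auto dest: inj_onD)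
    then show ?thesis
      using u(2) graph_iso_laplacian[OF simple G(2,3) y(1), of u'] graph_iso_degree[OF simple G(2,3) y(1)]
      by (simp add: hitting_time_def)
  qed
  then have "hitting_time G w (u' \<circ> \<alpha>)"
    using u(2) by (simp add: hitting_time_def)
  then show ?thesis using hitting_time_unique[OF _ u(1) w] by fastforce
qed

section \<open>Components and cell graphs\<close>

lemma adj_induced_subgraph: "adj (induced_subgraph X S) x y \<longleftrightarrow> adj X x y \<and> x \<in> S \<and> y \<in> S"
  by (auto simp: adj_def induced_subgraph_def)

lemma complement_components_iff:
  assumes "simple_graph X"
  shows "C \<in> complement_components X P \<longleftrightarrow>
    (\<exists>x\<in>verts X - P. C = {y. (\<lambda>a b. adj X a b \<and> a \<notin> P \<and> b \<notin> P)\<^sup>*\<^sup>* x y})"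
proof -
  have "adj (induced_subgraph X (verts X - P)) = (\<lambda>a b. adj X a b \<and> a \<notin> P \<and> b \<notin> P)"
    using adj_verts[OF assms] by (auto simp: adj_induced_subgraph fun_eq_iff)
  then show ?thesis unfolding complement_components_def by auto
qed

context
  fixes X :: "'a graph"
  assumes simple: "simple_graph X"
begin

lemma component_subset: "C \<in> complement_components X P \<Longrightarrow> C \<subseteq> verts X - P"
proof
  fix y assume "C \<in> complement_components X P" and y: "y \<in> C"
  then obtain x where x: "x \<in> verts X - P" "(\<lambda>a b. adj X a b \<and> a \<notin> P \<and> b \<notin> P)\<^sup>*\<^sup>* x y"
    unfolding complement_components_iff[OF simple] by blast
  from x(2,1) show "y \<in> verts X - P"
    using adj_verts[OF simple] by (cases rule: rtranclp.cases) auto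
qed

lemma component_nonempty: "C \<in> complement_components X P \<Longrightarrow> C \<noteq> {}"
  unfolding complement_components_iff[OF simple] by blast

lemma ex_component: "x \<in> verts X \<Longrightarrow> x \<notin> P \<Longrightarrow> \<exists>C\<in>complement_components X P. x \<in> C"
  unfolding Bex_def complement_components_iff[OF simple] by blast

lemma component_closed:
  assumes "C \<in> complement_components X P" "x \<in> C" "adj X x y" "y \<notin> P"
  shows "y \<in> C"
  using assms component_subset[OF assms(1)] unfolding complement_components_iff[OF simple]
  by (auto intro: rtranclp.rtrancl_into_rtrancl)

text \<open>Serves as the induction principle for components. The vertex \<open>x\<close> may differ
  from the vertex that generates \<open>C\<close>, so the path between the two is first
  reversed.\<close>

lemma component_least:
  assumes "C \<in> complement_components X P" "x \<in> C" "x \<in> U"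
    and closed: "\<And>y z. y \<in> U \<Longrightarrow> y \<notin> P \<Longrightarrow> adj X y z \<Longrightarrow> z \<notin> P \<Longrightarrow> z \<in> U"
  shows "C \<subseteq> U"
proof
  fix y assume "y \<in> C"
  obtain a where a: "(\<lambda>a b. adj X a b \<and> a \<notin> P \<and> b \<notin> P)\<^sup>*\<^sup>* a x"
      "(\<lambda>a b. adj X a b \<and> a \<notin> P \<and> b \<notin> P)\<^sup>*\<^sup>* a y"
    using assms(1,2) \<open>y \<in> C\<close> unfolding complement_components_iff[OF simple] by blast
  have "symp (\<lambda>a b. adj X a b \<and> a \<notin> P \<and> b \<notin> P)"
    by (auto simp: symp_def adj_commute)
  then have "(\<lambda>a b. adj X a b \<and> a \<notin> P \<and> b \<notin> P)\<^sup>*\<^sup>* x a"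
    using a(1) by (rule sympD[OF symp_rtranclp])
  then have "(\<lambda>a b. adj X a b \<and> a \<notin> P \<and> b \<notin> P)\<^sup>*\<^sup>* x y"
    using a(2) by (rule rtranclp_trans)
  then show "y \<in> U"
    by (induction rule: rtranclp_induct) (use assms(3) closed in auto)
qed

lemma component_unique:
  assumes "C \<in> complement_components X P" "D \<in> complement_components X P" "x \<in> C" "x \<in> D"
  shows "C = D"
  using component_least[OF assms(1,3,4)] component_least[OF assms(2,4,3)]
    component_closed[OF assms(1)] component_closed[OF assms(2)] by blast

lemma component_mono:
  assumes "C \<in> complement_components X P" "D \<in> complement_components X P'" "P' \<subseteq> P" "x \<in> C" "x \<in> D"
  shows "C \<subseteq> D"
  using component_least[OF assms(1,4), of D] component_closed[OF assms(2)] assms(3,5) by blast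

lemma boundary_component_subset: "C \<in> complement_components X P \<Longrightarrow> boundary X C \<subseteq> P"
proof
  fix x assume C: "C \<in> complement_components X P" and "x \<in> boundary X C"
  then obtain y where "y \<in> C" "adj X y x" "x \<notin> C"
    by (auto simp: boundary_def adj_commute)
  then show "x \<in> P" using component_closed[OF C] by blast
qed

lemma boundaryI:
  assumes "C \<in> complement_components X P" "y \<in> C" "adj X y x" "x \<in> P"
  shows "x \<in> boundary X C"
  using assms component_subset[OF assms(1)] adj_verts[OF simple assms(3)]
  unfolding boundary_def by (auto simp: adj_commute)

lemma verts_closure_graph:
  assumes "C \<in> complement_components X P"
  shows "verts (closure_graph X C) = C \<union> boundary X C"
  using component_subset[OF assms] by (auto simp: closure_graph_def induced_subgraph_def boundary_def)

lemma adj_closure_graph: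
  "adj (closure_graph X C) x y \<longleftrightarrow> adj X x y \<and> x \<in> C \<union> boundary X C \<and> y \<in> C \<union> boundary X C"
  unfolding closure_graph_def adj_induced_subgraph ..

lemma simple_closure_graph: "simple_graph (closure_graph X C)"
  unfolding simple_graph_def
proof
  fix e assume e: "e \<in> edges (closure_graph X C)"
  then have "e \<in> edges X" by (simp add: closure_graph_def induced_subgraph_def)
  then obtain x y where xy: "e = {x, y}" "x \<in> verts X" "y \<in> verts X" "x \<noteq> y"
    using simple by (auto simp: simple_graph_def)
  then have "x \<in> verts (closure_graph X C)" "y \<in> verts (closure_graph X C)"
    using e by (auto simp: closure_graph_def induced_subgraph_def)
  then show "e \<in> {{x, y} |x y. x \<in> verts (closure_graph X C) \<and> y \<in> verts (closure_graph X C) \<and> x \<noteq> y}"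
    using xy by blast
qed

text \<open>Paths in X that start in \<open>C\<close> and avoid \<open>P\<close> stay in
  \<open>C\<close>, hence run in the cell graph; a boundary vertex has a neighbour in
  \<open>C\<close>.\<close>

lemma connected_closure_graph:
  assumes C: "C \<in> complement_components X P"
  shows "connected_graph (closure_graph X C)"
proof -
  let ?R = "(adj (closure_graph X C))\<^sup>*\<^sup>*"
  have inner: "?R x y" if x: "x \<in> C" and y: "y \<in> C" for x y
  proof -
    have "C \<subseteq> {z \<in> C. ?R x z}"
    proof (rule component_least[OF C x])
      fix y z assume "y \<in> {z \<in> C. ?R x z}" "adj X y z" "z \<notin> P"
      moreover from this have "z \<in> C" using component_closed[OF C] by blast
      ultimately show "z \<in> {z \<in> C. ?R x z}"
        by (auto simp: adj_closure_graph intro: rtranclp.rtrancl_into_rtrancl)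
    qed (use x in auto)
    then show ?thesis using y by blast
  qed
  have near: "\<exists>y\<in>C. ?R x y \<and> ?R y x" if x: "x \<in> C \<union> boundary X C" for x
  proof (cases "x \<in> C")
    case False
    then obtain y where "y \<in> C" "adj X x y" using x by (auto simp: boundary_def)
    then have "adj (closure_graph X C) x y" "adj (closure_graph X C) y x"
      using x by (auto simp: adj_closure_graph adj_commute)
    then show ?thesis using \<open>y \<in> C\<close> by blast
  qed blast
  have "?R x y" if xy: "x \<in> C \<union> boundary X C" "y \<in> C \<union> boundary X C" for x y
  proof -
    obtain x' y' where "x' \<in> C" "?R x x'" "y' \<in> C" "?R y' y"
      using near[OF xy(1)] near[OF xy(2)] by blast
    then show ?thesis using inner[of x' y'] by (blast intro: rtranclp_trans)
  qed
  then show ?thesis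
    using component_nonempty[OF C] unfolding connected_graph_def verts_closure_graph[OF C] by blast
qed

end

section \<open>Symmetrically self-similar graphs\<close>

locale symmetrically_self_similar_graph =
  fixes X :: "'a graph" and F :: "'a set" and \<psi> :: "'a \<Rightarrow> 'a"
  assumes sss: "symmetrically_self_similar X F \<psi>"
begin

lemma simple: "simple_graph X"
  and connected: "connected_graph X"
  and infinite_verts: "infinite (verts X)"
  and F_subset: "F \<subseteq> verts X"
  and F_not_adj: "x \<in> F \<Longrightarrow> y \<in> F \<Longrightarrow> \<not> adj X x y"
  and iso: "graph_iso \<psi> X (reduced_graph X F)"
  and finite_neighbours: "x \<in> verts X \<Longrightarrow> finite (neighbours X x)"
  and finite_cell: "C \<in> cells X F \<Longrightarrow> finite C"
  using sss unfolding symmetrically_self_similar_def self_similar_def locally_finite_graph_def by auto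

lemma boundary_Int:
  assumes "C \<in> cells X F" "D \<in> cells X F" "x \<in> boundary X C" "x \<in> boundary X D"
    "y \<in> boundary X C" "y \<in> boundary X D" "x \<noteq> y"
  shows "C = D"
  using sss assms unfolding symmetrically_self_similar_def self_similar_def by blast

lemma ex_cell_iso:
  assumes "C \<in> cells X F" "D \<in> cells X F"
  obtains \<alpha> where "graph_iso \<alpha> (closure_graph X C) (closure_graph X D)" "\<alpha> ` boundary X C = boundary X D"
proof -
  have "\<forall>C\<in>cells X F. \<forall>D\<in>cells X F. \<exists>\<alpha>. graph_iso \<alpha> (closure_graph X C) (closure_graph X D) \<and>
      \<alpha> ` boundary X C = boundary X D"
    using sss unfolding symmetrically_self_similar_def by (elim conjE)
  then show thesis using assms that by meson
qed

lemma ex_cell_automorphism: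
  assumes "C \<in> cells X F" "x \<in> boundary X C" "y \<in> boundary X C" "x' \<in> boundary X C" "y' \<in> boundary X C"
    "x \<noteq> y" "x' \<noteq> y'"
  obtains \<alpha> where "graph_iso \<alpha> (closure_graph X C) (closure_graph X C)" "\<alpha> x = x'" "\<alpha> y = y'"
  using sss assms unfolding symmetrically_self_similar_def by blast

lemma bij_\<psi>: "bij_betw \<psi> (verts X) F"
  using iso by (simp add: graph_iso_def reduced_graph_def)

lemma \<psi>_image: "\<psi> ` verts X = F"
  using bij_\<psi> by (simp add: bij_betw_def)

lemma inj_\<psi>: "inj_on \<psi> (verts X)"
  using bij_\<psi> by (simp add: bij_betw_def)

lemma \<psi>_eq_iff: "x \<in> verts X \<Longrightarrow> y \<in> verts X \<Longrightarrow> \<psi> x = \<psi> y \<longleftrightarrow> x = y"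
  using inj_\<psi> by (auto dest: inj_onD)

lemma \<psi>_F_iff: "x \<in> verts X \<Longrightarrow> \<psi> x \<in> \<psi> ` F \<longleftrightarrow> x \<in> F"
  using F_subset \<psi>_eq_iff by blast

lemma \<psi>_F_subset: "\<psi> ` F \<subseteq> F"
  using \<psi>_image F_subset by blast

text \<open>Condition (F3) rewritten in terms of boundaries. The complete graphs in the cell graphs
  come from here.\<close>

lemma adj_iff:
  assumes "x \<in> verts X" "y \<in> verts X"
  shows "adj X x y \<longleftrightarrow> x \<noteq> y \<and> (\<exists>D\<in>cells X F. \<psi> x \<in> boundary X D \<and> \<psi> y \<in> boundary X D)"
proof -
  have F: "\<psi> x \<in> F" "\<psi> y \<in> F" using assms \<psi>_image by auto
  have "adj X x y \<longleftrightarrow> adj (reduced_graph X F) (\<psi> x) (\<psi> y)"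
    using iso assms by (simp add: graph_iso_def)
  also have "\<dots> \<longleftrightarrow> \<psi> x \<noteq> \<psi> y \<and> (\<exists>D\<in>cells X F. \<psi> x \<in> boundary X D \<and> \<psi> y \<in> boundary X D)"
    unfolding adj_def reduced_graph_def using F by (auto simp: doubleton_eq_iff)
  finally show ?thesis using \<psi>_eq_iff[OF assms] by simp
qed

section \<open>Finiteness and size of cells and their boundaries\<close>

lemma finite_boundary:
  assumes "C \<in> cells X F"
  shows "finite (boundary X C)"
proof (rule finite_subset)
  show "boundary X C \<subseteq> (\<Union>y\<in>C. neighbours X y)"
    by (auto simp: boundary_def neighbours_def adj_commute)
  show "finite (\<Union>y\<in>C. neighbours X y)"
    using component_subset[OF simple assms] finite_neighbours
    by (intro finite_UN_I finite_cell[OF assms]) auto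
qed

lemma cell_graph_verts: "C \<in> cells X F \<Longrightarrow> verts (closure_graph X C) = C \<union> boundary X C"
  by (rule verts_closure_graph[OF simple])

lemma cell_graph_verts_subset: "C \<in> cells X F \<Longrightarrow> C \<union> boundary X C \<subseteq> verts X"
  using component_subset[OF simple] by (auto simp: boundary_def)

lemma finite_connected_cell_graph:
  assumes "C \<in> cells X F"
  shows "finite_connected_graph (closure_graph X C)"
  using simple_closure_graph[OF simple] connected_closure_graph[OF simple assms]
    finite_cell[OF assms] finite_boundary[OF assms]
  by unfold_locales (auto simp: cell_graph_verts[OF assms])

lemma card_boundary_eq:
  assumes "C \<in> cells X F" "D \<in> cells X F"
  shows "card (boundary X C) = card (boundary X D)"
proof -
  obtain \<alpha> where \<alpha>: "graph_iso \<alpha> (closure_graph X C) (closure_graph X D)"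
      "\<alpha> ` boundary X C = boundary X D"
    by (rule ex_cell_iso[OF assms])
  have "inj_on \<alpha> (boundary X C)"
    using \<alpha>(1) cell_graph_verts[OF assms(1)] unfolding graph_iso_def bij_betw_def
    by (metis inj_on_subset sup_ge2)
  then show ?thesis using \<alpha>(2) card_image by metis
qed

text \<open>Connectedness yields an edge of X; the images of its ends are two boundary vertices of
  one cell, and all cells have equally large boundaries.\<close>

lemma card_boundary_ge_2:
  assumes "C \<in> cells X F"
  shows "card (boundary X C) \<ge> 2"
proof -
  obtain x where x: "x \<in> verts X" using infinite_verts by (metis ex_in_conv finite.emptyI)
  have "infinite (verts X - {x})" using infinite_verts by simp
  then obtain y where y: "y \<in> verts X" "y \<noteq> x" by (metis DiffE ex_in_conv finite.emptyI insertI1)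
  have "(adj X)\<^sup>*\<^sup>* x y" using connected x y unfolding connected_graph_def by blast
  then obtain z where z: "adj X x z" using y by (metis converse_rtranclpE)
  then obtain D where D: "D \<in> cells X F" "\<psi> x \<in> boundary X D" "\<psi> z \<in> boundary X D" "x \<noteq> z"
    using adj_iff adj_verts[OF simple z] by blast
  then have "card {\<psi> x, \<psi> z} \<le> card (boundary X D)"
    using finite_boundary by (intro card_mono) auto
  moreover have "\<psi> x \<noteq> \<psi> z" using \<psi>_eq_iff adj_verts[OF simple z] by blast
  ultimately show ?thesis using card_boundary_eq[OF assms D(1)] by simp
qed

lemma ex_other_boundary_vertex:
  assumes "C \<in> cells X F"
  shows "\<exists>y\<in>boundary X C. y \<noteq> x"
proof (rule ccontr)
  assume "\<not> ?thesis"
  then have "boundary X C \<subseteq> {x}" by blast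
  then have "card (boundary X C) \<le> card {x}" by (intro card_mono) auto
  then show False using card_boundary_ge_2[OF assms] by simp
qed

text \<open>Describes the 1-cells in the 2-cell of \<open>C\<close> without mentioning 2-cells; the
  agreement is \<open>subcells_two_cell_of\<close>. The boundary has to meet the image of
  \<open>C\<close> itself, contact with the image of the boundary of \<open>C\<close> does not
  count.\<close>

definition clique_cells :: "'a set \<Rightarrow> 'a set set" where
  "clique_cells C = {D \<in> cells X F. boundary X D \<inter> \<psi> ` C \<noteq> {}}"

text \<open>A boundary vertex of \<open>D\<close> other than \<open>\<psi> c\<close> is the image of
  a neighbour of \<open>c\<close>, and neighbours of \<open>c\<close> lie in \<open>C\<close> or its
  boundary.\<close>

lemma boundary_clique_cell:
  assumes C: "C \<in> cells X F" and D: "D \<in> clique_cells C"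
  shows "boundary X D \<subseteq> \<psi> ` (C \<union> boundary X C)"
proof
  fix y assume y: "y \<in> boundary X D"
  have Dc: "D \<in> cells X F" using D by (simp add: clique_cells_def)
  obtain c where c: "c \<in> C" "\<psi> c \<in> boundary X D" using D by (auto simp: clique_cells_def)
  have cV: "c \<in> verts X" using c cell_graph_verts_subset[OF C] by blast
  obtain z where z: "z \<in> verts X" "y = \<psi> z"
    using y boundary_component_subset[OF simple Dc] \<psi>_image by blast
  show "y \<in> \<psi> ` (C \<union> boundary X C)"
  proof (cases "z = c")
    case False
    then have "adj X c z" using adj_iff[OF cV z(1)] c y z Dc by blast
    then have "z \<in> C \<union> boundary X C"
      using component_closed[OF simple C c(1)] boundaryI[OF simple C c(1)] by blast
    then show ?thesis using z by blast
  qed (use c z in blast)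
qed

section \<open>1-cells inside 2-cells\<close>

lemma cell_subset_two_cell:
  assumes "D \<in> cells X F" "C2 \<in> two_cells X F \<psi>" "x \<in> boundary X D" "x \<in> C2"
  shows "D \<subseteq> C2"
proof -
  obtain d where d: "d \<in> D" "adj X x d" using assms(3) by (auto simp: boundary_def)
  have "d \<notin> \<psi> ` F" using d component_subset[OF simple assms(1)] \<psi>_F_subset by blast
  then have "d \<in> C2" using component_closed[OF simple assms(2,4) d(2)] by blast
  then show ?thesis using component_mono[OF simple assms(1,2) \<psi>_F_subset d(1)] by blast
qed

lemma image_subset_two_cell:
  assumes C: "C \<in> cells X F" and C2: "C2 \<in> two_cells X F \<psi>" and c: "c \<in> C" "\<psi> c \<in> C2"
  shows "\<psi> ` C \<subseteq> C2"
proof -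
  have "C \<subseteq> {x \<in> verts X. \<psi> x \<in> C2}"
  proof (rule component_least[OF simple C c(1)])
    show "c \<in> {x \<in> verts X. \<psi> x \<in> C2}" using c cell_graph_verts_subset[OF C] by blast
  next
    fix y z assume y: "y \<in> {x \<in> verts X. \<psi> x \<in> C2}" and yz: "adj X y z" and z: "z \<notin> F"
    have zV: "z \<in> verts X" using adj_verts[OF simple yz] by blast
    obtain D where D: "D \<in> cells X F" "\<psi> y \<in> boundary X D" "\<psi> z \<in> boundary X D"
      using adj_iff y yz zV by blast
    have "D \<subseteq> C2" using cell_subset_two_cell[OF D(1) C2 D(2)] y by blast
    moreover obtain d where "d \<in> D" "adj X d (\<psi> z)"
      using D(3) by (auto simp: boundary_def adj_commute)
    ultimately have "\<psi> z \<in> C2"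
      using component_closed[OF simple C2] \<psi>_F_iff[OF zV] z by blast
    then show "z \<in> {x \<in> verts X. \<psi> x \<in> C2}" using zV by blast
  qed
  then show ?thesis by blast
qed

text \<open>The right-hand side is closed under steps avoiding \<open>\<psi>\<close>
  F\<open>. By (F1) a step from\<close>\<psi> \<open>C\<close> enters a clique cell; a step out of a
  clique cell hits its boundary, which lies in \<open>\<psi>\<close>
  C\<open>apart from points of\<close>\<psi> \<open>F\<close>.\<close>

lemma two_cell_subset:
  assumes C: "C \<in> cells X F" and C2: "C2 \<in> two_cells X F \<psi>" and c: "c \<in> C" "\<psi> c \<in> C2"
  shows "C2 \<subseteq> \<psi> ` C \<union> \<Union>(clique_cells C)"
proof (rule component_least[OF simple C2 c(2)])
  show "\<psi> c \<in> \<psi> ` C \<union> \<Union>(clique_cells C)" using c by blast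
next
  fix y z
  assume y: "y \<in> \<psi> ` C \<union> \<Union>(clique_cells C)" and yz: "adj X y z" and z: "z \<notin> \<psi> ` F"
  have zV: "z \<in> verts X" using adj_verts[OF simple yz] by blast
  show "z \<in> \<psi> ` C \<union> \<Union>(clique_cells C)"
  proof (cases "y \<in> \<psi> ` C")
    case True
    then have yF: "y \<in> F" using cell_graph_verts_subset[OF C] \<psi>_image by blast
    then have "z \<notin> F" using F_not_adj yz by blast
    then obtain D where D: "D \<in> cells X F" "z \<in> D" using ex_component[OF simple zV] by blast
    moreover have "y \<in> boundary X D"
      using boundaryI[OF simple D] yz yF by (simp add: adj_commute)
    ultimately show ?thesis using True by (auto simp: clique_cells_def)
  next
    case False
    then obtain D where D: "D \<in> clique_cells C" "y \<in> D" using y by blast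
    then have Dc: "D \<in> cells X F" by (simp add: clique_cells_def)
    show ?thesis
    proof (cases "z \<in> F")
      case True
      then have "z \<in> boundary X D" using boundaryI[OF simple Dc D(2) yz] by blast
      then obtain x where x: "x \<in> C \<union> boundary X C" "z = \<psi> x"
        using boundary_clique_cell[OF C D(1)] by blast
      then have "x \<notin> F" using z by blast
      then show ?thesis using x boundary_component_subset[OF simple C] by blast
    next
      case False
      then show ?thesis using component_closed[OF simple Dc D(2) yz] D by blast
    qed
  qed
qed

lemma subcells_eq:
  assumes C: "C \<in> cells X F" and C2: "C2 \<in> two_cells X F \<psi>" and c: "c \<in> C" "\<psi> c \<in> C2"
  shows "subcells X F C2 = clique_cells C"
proof (intro Set.set_eqI iffI)
  fix D assume D: "D \<in> subcells X F C2"
  then have Dc: "D \<in> cells X F" "D \<subseteq> C2" by (auto simp: subcells_def)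
  obtain d where d: "d \<in> D" using component_nonempty[OF simple Dc(1)] by blast
  have "d \<notin> F" using d component_subset[OF simple Dc(1)] by blast
  then have "d \<notin> \<psi> ` C" using cell_graph_verts_subset[OF C] \<psi>_image by blast
  then obtain D' where D': "D' \<in> clique_cells C" "d \<in> D'"
    using d Dc two_cell_subset[OF assms] by blast
  then have "D = D'"
    using component_unique[OF simple Dc(1) _ d] by (auto simp: clique_cells_def)
  then show "D \<in> clique_cells C" using D' by simp
next
  fix D assume "D \<in> clique_cells C"
  then obtain x where "D \<in> cells X F" "x \<in> boundary X D" "x \<in> \<psi> ` C"
    by (auto simp: clique_cells_def)
  moreover from this have "D \<subseteq> C2"
    using image_subset_two_cell[OF assms] cell_subset_two_cell[OF _ C2] by blast
  ultimately show "D \<in> subcells X F C2" by (simp add: subcells_def)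
qed

lemma ex_two_cell:
  assumes C: "C \<in> cells X F" and c: "c \<in> C"
  obtains C2 where "C2 \<in> two_cells X F \<psi>" "\<psi> c \<in> C2"
proof -
  have cV: "c \<in> verts X" "c \<notin> F" using c component_subset[OF simple C] by auto
  then have "\<psi> c \<in> verts X" "\<psi> c \<notin> \<psi> ` F" using \<psi>_F_iff \<psi>_image F_subset by blast+
  then show thesis using ex_component[OF simple] that by blast
qed

text \<open>Needed because \<open>mass_scaling\<close> quantifies over all 2-cells, while the
  counting is done cell by cell.\<close>

lemma ex_cell_of_two_cell:
  assumes C2: "C2 \<in> two_cells X F \<psi>"
  shows "\<exists>C\<in>cells X F. \<exists>c\<in>C. \<psi> c \<in> C2"
proof -
  have suff: ?thesis if c: "\<psi> c \<in> C2" "c \<in> verts X" for c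
  proof -
    have "c \<notin> F" using c component_subset[OF simple C2] by blast
    then show ?thesis using ex_component[OF simple c(2)] c(1) by blast
  qed
  obtain x where x: "x \<in> C2" using component_nonempty[OF simple C2] by blast
  show ?thesis
  proof (cases "x \<in> F")
    case True
    then show ?thesis using suff x \<psi>_image by blast
  next
    case False
    then obtain D where D: "D \<in> cells X F" "x \<in> D"
      using ex_component[OF simple] x component_subset[OF simple C2] by blast
    have DC2: "D \<subseteq> C2" by (rule component_mono[OF simple D(1) C2 \<psi>_F_subset D(2) x])
    obtain a where a: "a \<in> boundary X D" using ex_other_boundary_vertex[OF D(1)] by blast
    obtain b where b: "b \<in> boundary X D" "b \<noteq> a" using ex_other_boundary_vertex[OF D(1)] by blast
    obtain a' b' where ab: "a' \<in> verts X" "b' \<in> verts X" "a = \<psi> a'" "b = \<psi> b'"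
      using a b boundary_component_subset[OF simple D(1)] \<psi>_image by blast
    \<comment> \<open>Two boundary vertices of \<open>D\<close> have adjacent preimages, which by
      (F1) cannot both lie in \<open>F\<close>.\<close>
    have "adj X a' b'" using adj_iff[OF ab(1,2)] a b ab D(1) by blast
    then obtain c where c: "c \<in> verts X" "c \<notin> F" "\<psi> c \<in> boundary X D"
      using F_not_adj a b ab by blast
    obtain d where d: "d \<in> D" "adj X d (\<psi> c)"
      using c(3) by (auto simp: boundary_def adj_commute)
    have "\<psi> c \<in> C2"
      using component_closed[OF simple C2 _ d(2)] d(1) DC2 \<psi>_F_iff[OF c(1)] c(2) by blast
    then show ?thesis using suff c(1) by blast
  qed
qed

lemma subcells_two_cell_of:
  assumes C: "C \<in> cells X F"
  shows "subcells X F (two_cell_of X F \<psi> C) = clique_cells C"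
proof -
  obtain c where c: "c \<in> C" using component_nonempty[OF simple C] by blast
  obtain C2 where C2: "C2 \<in> two_cells X F \<psi>" "\<psi> c \<in> C2" by (rule ex_two_cell[OF C c])
  have "two_cell_of X F \<psi> C = C2"
    unfolding two_cell_of_def
  proof (rule the_equality)
    show "C2 \<in> two_cells X F \<psi> \<and> \<psi> ` C \<subseteq> C2"
      using image_subset_two_cell[OF C C2(1) c C2(2)] C2 by blast
  next
    fix C3 assume "C3 \<in> two_cells X F \<psi> \<and> \<psi> ` C \<subseteq> C3"
    then show "C3 = C2" using component_unique[OF simple _ C2(1) _ C2(2)] c by blast
  qed
  then show ?thesis using subcells_eq[OF C C2(1) c C2(2)] by simp
qed

lemma finite_clique_cells:
  assumes C: "C \<in> cells X F"
  shows "finite (clique_cells C)"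
proof -
  define N where "N = (\<Union>c\<in>C. neighbours X (\<psi> c))"
  have CV: "\<psi> ` C \<subseteq> verts X" using cell_graph_verts_subset[OF C] \<psi>_image F_subset by blast
  have "finite N" unfolding N_def using finite_cell[OF C] finite_neighbours CV by blast
  have "\<exists>d\<in>N. d \<in> D" if "D \<in> clique_cells C" for D
    using that by (auto simp: clique_cells_def boundary_def N_def neighbours_def)
  then obtain f where f: "\<And>D. D \<in> clique_cells C \<Longrightarrow> f D \<in> N \<and> f D \<in> D" by metis
  have "inj_on f (clique_cells C)"
  proof (rule inj_onI)
    fix D E assume DE: "D \<in> clique_cells C" "E \<in> clique_cells C" "f D = f E"
    then show "D = E"
      using component_unique[OF simple, of D F E "f D"] f[of D] f[of E] by (auto simp: clique_cells_def)
  qed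
  moreover have "f ` clique_cells C \<subseteq> N" using f by blast
  ultimately show ?thesis using \<open>finite N\<close> finite_imageD finite_subset by metis
qed

section \<open>The cell graph as a union of complete graphs\<close>

lemma image_neighbours_cell_graph:
  assumes C: "C \<in> cells X F" and x: "x \<in> C \<union> boundary X C"
  shows "\<psi> ` neighbours (closure_graph X C) x =
    (\<Union>D\<in>{D \<in> clique_cells C. \<psi> x \<in> boundary X D}. boundary X D - {\<psi> x})"
proof (intro Set.set_eqI iffI)
  have V: "C \<union> boundary X C \<subseteq> verts X" by (rule cell_graph_verts_subset[OF C])
  fix y
  {
    assume "y \<in> \<psi> ` neighbours (closure_graph X C) x"
    then obtain z where z: "adj X x z" "z \<in> C \<union> boundary X C" "y = \<psi> z"
      by (auto simp: neighbours_def adj_closure_graph[OF simple])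
    then obtain D where D: "D \<in> cells X F" "\<psi> x \<in> boundary X D" "\<psi> z \<in> boundary X D" "x \<noteq> z"
      using adj_iff x V by blast
    \<comment> \<open>Both ends on the boundary of \<open>C\<close> would be adjacent vertices of
      \<open>F\<close>. An end in \<open>C\<close> is what makes \<open>D\<close> a clique
      cell.\<close>
    have "x \<in> C \<or> z \<in> C"
      using z x F_not_adj boundary_component_subset[OF simple C] by blast
    then have "D \<in> clique_cells C" using D by (auto simp: clique_cells_def)
    moreover have "\<psi> z \<noteq> \<psi> x" using \<psi>_eq_iff D(4) x z V by blast
    ultimately show "y \<in> (\<Union>D\<in>{D \<in> clique_cells C. \<psi> x \<in> boundary X D}. boundary X D - {\<psi> x})"
      using D z by blast
  next
    assume "y \<in> (\<Union>D\<in>{D \<in> clique_cells C. \<psi> x \<in> boundary X D}. boundary X D - {\<psi> x})"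
    then obtain D where D: "D \<in> clique_cells C" "\<psi> x \<in> boundary X D" "y \<in> boundary X D" "y \<noteq> \<psi> x"
      by blast
    then obtain z where z: "z \<in> C \<union> boundary X C" "y = \<psi> z"
      using boundary_clique_cell[OF C D(1)] by blast
    have "adj X x z"
      using adj_iff[of x z] x z V D by (auto simp: clique_cells_def)
    then show "y \<in> \<psi> ` neighbours (closure_graph X C) x"
      using x z by (auto simp: neighbours_def adj_closure_graph[OF simple])
  }
qed

text \<open>By (F2) the boundaries of distinct cells through \<open>\<psi> x\<close> share no
  further vertex, so each such clique contributes its remaining vertices separately.\<close>

lemma degree_cell_graph:
  assumes C: "C \<in> cells X F" and x: "x \<in> C \<union> boundary X C"
  shows "degree (closure_graph X C) x =
    (card (boundary X C) - 1) * card {D \<in> clique_cells C. \<psi> x \<in> boundary X D}"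
proof -
  let ?I = "{D \<in> clique_cells C. \<psi> x \<in> boundary X D}"
  have "neighbours (closure_graph X C) x \<subseteq> verts X"
    using cell_graph_verts_subset[OF C] by (auto simp: neighbours_def adj_closure_graph[OF simple])
  then have "degree (closure_graph X C) x = card (\<psi> ` neighbours (closure_graph X C) x)"
    unfolding degree_def using inj_\<psi> by (metis card_image inj_on_subset)
  also have "\<dots> = card (\<Union>D\<in>?I. boundary X D - {\<psi> x})"
    unfolding image_neighbours_cell_graph[OF assms] ..
  also have "\<dots> = (\<Sum>D\<in>?I. card (boundary X D - {\<psi> x}))"
  proof (rule card_UN_disjoint)
    show "finite ?I" using finite_clique_cells[OF C] by simp
    show "\<forall>D\<in>?I. finite (boundary X D - {\<psi> x})" using finite_boundary by (auto simp: clique_cells_def)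
    show "\<forall>D\<in>?I. \<forall>E\<in>?I. D \<noteq> E \<longrightarrow> (boundary X D - {\<psi> x}) \<inter> (boundary X E - {\<psi> x}) = {}"
      using boundary_Int by (fastforce simp: clique_cells_def)
  qed
  also have "\<dots> = (\<Sum>D\<in>?I. card (boundary X C) - 1)"
  proof (rule sum.cong)
    fix D assume "D \<in> ?I"
    then show "card (boundary X D - {\<psi> x}) = card (boundary X C) - 1"
      using card_boundary_eq[OF C, of D] by (auto simp: clique_cells_def card_Diff_singleton)
  qed simp
  finally show ?thesis by simp
qed

text \<open>Sum the degrees and count the incidences between vertices and cliques from the side of
  the cliques.\<close>

lemma total_degree_cell_graph:
  assumes C: "C \<in> cells X F"
  shows "total_degree (closure_graph X C) =
    (card (boundary X C) - 1) * (card (boundary X C) * card (clique_cells C))"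
proof -
  let ?V = "C \<union> boundary X C"
  have "total_degree (closure_graph X C) =
      (\<Sum>x\<in>?V. (card (boundary X C) - 1) * card {D \<in> clique_cells C. \<psi> x \<in> boundary X D})"
    unfolding total_degree_def cell_graph_verts[OF C] using degree_cell_graph[OF C] by simp
  also have "\<dots> = (card (boundary X C) - 1) * (\<Sum>x\<in>?V. card {D \<in> clique_cells C. \<psi> x \<in> boundary X D})"
    by (simp add: sum_distrib_left)
  also have "(\<Sum>x\<in>?V. card {D \<in> clique_cells C. \<psi> x \<in> boundary X D}) =
      card (boundary X C) * card (clique_cells C)"
  proof (rule sum_multicount)
    show "finite ?V" using finite_cell[OF C] finite_boundary[OF C] by simp
    show "finite (clique_cells C)" by (rule finite_clique_cells[OF C])
    show "\<forall>D\<in>clique_cells C. card {x \<in> ?V. \<psi> x \<in> boundary X D} = card (boundary X C)"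
    proof
      fix D assume D: "D \<in> clique_cells C"
      have "inj_on \<psi> {x \<in> ?V. \<psi> x \<in> boundary X D}"
        using cell_graph_verts_subset[OF C] by (intro inj_on_subset[OF inj_\<psi>]) auto
      then have "card (\<psi> ` {x \<in> ?V. \<psi> x \<in> boundary X D}) = card {x \<in> ?V. \<psi> x \<in> boundary X D}"
        by (rule card_image)
      moreover have "\<psi> ` {x \<in> ?V. \<psi> x \<in> boundary X D} = boundary X D"
        using boundary_clique_cell[OF C D] by auto
      ultimately have "card {x \<in> ?V. \<psi> x \<in> boundary X D} = card (boundary X D)"
        by simp
      then show "card {x \<in> ?V. \<psi> x \<in> boundary X D} = card (boundary X C)"
        using card_boundary_eq[OF C, of D] D by (simp add: clique_cells_def)
    qed
  qed
  finally show ?thesis .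
qed

section \<open>Well-definedness of the mass scaling factor and the branching number\<close>

lemma vertex_branching_eq:
  assumes C: "C \<in> cells X F" and v: "v \<in> verts X"
  shows "vertex_branching X F \<psi> C v = card {D \<in> clique_cells C. \<psi> v \<in> boundary X D}"
proof -
  have "v \<in> inv_into (verts X) \<psi> ` boundary X D \<longleftrightarrow> \<psi> v \<in> boundary X D" if "D \<in> clique_cells C" for D
  proof
    have sub: "boundary X D \<subseteq> \<psi> ` verts X"
      using that boundary_component_subset[OF simple, of D F] \<psi>_image by (auto simp: clique_cells_def)
    show "\<psi> v \<in> boundary X D" if "v \<in> inv_into (verts X) \<psi> ` boundary X D"
      using that sub by (auto simp: f_inv_into_f)
    show "v \<in> inv_into (verts X) \<psi> ` boundary X D" if "\<psi> v \<in> boundary X D"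
      using that v inj_\<psi> by (metis image_eqI inv_into_f_f)
  qed
  then show ?thesis
    unfolding vertex_branching_def subcells_two_cell_of[OF C] by (intro arg_cong[of _ _ card] Collect_cong) blast
qed

text \<open>Rather than transporting cliques along an isomorphism, compare total degrees: these are
  invariant and determine the number of cliques, since boundaries have at least two
  vertices.\<close>

lemma card_clique_cells_eq:
  assumes "C \<in> cells X F" "D \<in> cells X F"
  shows "card (clique_cells C) = card (clique_cells D)"
proof -
  obtain \<alpha> where "graph_iso \<alpha> (closure_graph X C) (closure_graph X D)"
    by (rule ex_cell_iso[OF assms])
  then have "total_degree (closure_graph X D) = total_degree (closure_graph X C)"
    by (intro graph_iso_total_degree simple_closure_graph simple)
  then show ?thesis
    using card_boundary_ge_2[OF assms(1)] card_boundary_eq[OF assms]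
    by (simp add: total_degree_cell_graph assms)
qed

lemma mass_scaling_eq:
  assumes C: "C \<in> cells X F"
  shows "mass_scaling X F \<psi> = card (clique_cells C)"
  unfolding mass_scaling_def
proof (rule the_equality)
  show "\<forall>C2\<in>two_cells X F \<psi>. card (subcells X F C2) = card (clique_cells C)"
  proof
    fix C2 assume C2: "C2 \<in> two_cells X F \<psi>"
    then obtain D d where D: "D \<in> cells X F" "d \<in> D" "\<psi> d \<in> C2"
      using ex_cell_of_two_cell by blast
    show "card (subcells X F C2) = card (clique_cells C)"
      using subcells_eq[OF D(1) C2 D(2,3)] card_clique_cells_eq[OF C D(1)] by simp
  qed
next
  fix m assume m: "\<forall>C2\<in>two_cells X F \<psi>. card (subcells X F C2) = m"
  obtain c where c: "c \<in> C" using component_nonempty[OF simple C] by blast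
  obtain C2 where C2: "C2 \<in> two_cells X F \<psi>" "\<psi> c \<in> C2" by (rule ex_two_cell[OF C c])
  show "m = card (clique_cells C)" using m C2 subcells_eq[OF C C2(1) c C2(2)] by auto
qed

text \<open>Compose an isomorphism from (S1) with an automorphism of the target from (S2). The
  result need not map boundary to boundary.\<close>

lemma ex_cell_iso_pairs:
  assumes C: "C \<in> cells X F" "x \<in> boundary X C" "y \<in> boundary X C" "x \<noteq> y"
    and D: "D \<in> cells X F" "x' \<in> boundary X D" "y' \<in> boundary X D" "x' \<noteq> y'"
  obtains \<alpha> where "graph_iso \<alpha> (closure_graph X C) (closure_graph X D)" "\<alpha> x = x'" "\<alpha> y = y'"
proof -
  obtain \<alpha> where \<alpha>: "graph_iso \<alpha> (closure_graph X C) (closure_graph X D)"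
      "\<alpha> ` boundary X C = boundary X D"
    by (rule ex_cell_iso[OF C(1) D(1)])
  have "\<alpha> x \<noteq> \<alpha> y"
    using \<alpha>(1) C cell_graph_verts[OF C(1)] by (auto simp: graph_iso_def bij_betw_def dest: inj_onD)
  then obtain \<beta> where \<beta>: "graph_iso \<beta> (closure_graph X D) (closure_graph X D)"
      "\<beta> (\<alpha> x) = x'" "\<beta> (\<alpha> y) = y'"
    using ex_cell_automorphism[OF D(1) _ _ D(2,3) _ D(4)] \<alpha>(2) C by blast
  show thesis by (rule that[OF graph_iso_trans[OF \<alpha>(1) \<beta>(1)]]) (use \<beta> in auto)
qed

lemma degree_boundary_eq:
  assumes C: "C \<in> cells X F" "x \<in> boundary X C" and D: "D \<in> cells X F" "x' \<in> boundary X D"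
  shows "degree (closure_graph X D) x' = degree (closure_graph X C) x"
proof -
  obtain y where y: "y \<in> boundary X C" "x \<noteq> y" using ex_other_boundary_vertex[OF C(1)] by metis
  obtain y' where y': "y' \<in> boundary X D" "x' \<noteq> y'" using ex_other_boundary_vertex[OF D(1)] by metis
  obtain \<alpha> where \<alpha>: "graph_iso \<alpha> (closure_graph X C) (closure_graph X D)" "\<alpha> x = x'"
    by (rule ex_cell_iso_pairs[OF C y D y'])
  show ?thesis
    using graph_iso_degree[OF simple_closure_graph[OF simple] simple_closure_graph[OF simple] \<alpha>(1), of x]
      \<alpha>(2) C by (simp add: cell_graph_verts)
qed

text \<open>The branching of a boundary vertex is its degree divided by one less than the boundary
  size, and both are the same for all cells and boundary vertices.\<close>

lemma branching_number_eq:
  assumes C: "C \<in> cells X F" and v: "v \<in> boundary X C"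
  shows "branching_number X F \<psi> = vertex_branching X F \<psi> C v"
  unfolding branching_number_def
proof (rule the_equality)
  show "\<forall>D\<in>cells X F. \<forall>w\<in>boundary X D. vertex_branching X F \<psi> D w = vertex_branching X F \<psi> C v"
  proof (intro ballI)
    fix D w assume D: "D \<in> cells X F" and w: "w \<in> boundary X D"
    have V: "v \<in> verts X" "w \<in> verts X" using v w by (auto simp: boundary_def)
    show "vertex_branching X F \<psi> D w = vertex_branching X F \<psi> C v"
      using degree_boundary_eq[OF C v D w] card_boundary_ge_2[OF C] card_boundary_eq[OF C D] v w
      by (simp add: degree_cell_graph C D vertex_branching_eq V)
  qed
next
  fix b assume "\<forall>D\<in>cells X F. \<forall>w\<in>boundary X D. vertex_branching X F \<psi> D w = b"
  then show "b = vertex_branching X F \<psi> C v" using C v by simp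
qed

section \<open>Hitting times and the return function of a cell\<close>

lemma ex_hitting_time_cell:
  assumes C: "C \<in> cells X F" and w: "w \<in> boundary X C"
  shows "\<exists>u. hitting_time (closure_graph X C) w u"
proof -
  obtain a where "a \<in> boundary X C" "a \<noteq> w" using ex_other_boundary_vertex[OF C] by blast
  then show ?thesis
    using finite_connected_graph.ex_hitting_time[OF finite_connected_cell_graph[OF C]] w
    by (auto simp: cell_graph_verts[OF C])
qed

text \<open>\<open>h\<close> is chosen once for all cells, because \<open>time_scaling\<close>
  demands a value common to all of them.\<close>

lemma ex_boundary_hitting_time:
  "\<exists>h. \<forall>C\<in>cells X F. \<forall>w\<in>boundary X C. \<forall>x\<in>boundary X C. \<forall>u.
     x \<noteq> w \<longrightarrow> hitting_time (closure_graph X C) w u \<longrightarrow> u x = h"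
proof (cases "cells X F = {}")
  case False
  then obtain D where D: "D \<in> cells X F" by blast
  obtain w' where w': "w' \<in> boundary X D" using ex_other_boundary_vertex[OF D] by blast
  obtain x' where x': "x' \<in> boundary X D" "w' \<noteq> x'" using ex_other_boundary_vertex[OF D] by metis
  obtain u' where u': "hitting_time (closure_graph X D) w' u'"
    using ex_hitting_time_cell[OF D w'] by blast
  have "u x = u' x'"
    if C: "C \<in> cells X F" "w \<in> boundary X C" "x \<in> boundary X C" "w \<noteq> x"
      and u: "hitting_time (closure_graph X C) w u" for C w x u
  proof -
    obtain \<alpha> where \<alpha>: "graph_iso \<alpha> (closure_graph X D) (closure_graph X C)" "\<alpha> w' = w" "\<alpha> x' = x"
      by (rule ex_cell_iso_pairs[OF D w' x' C])
    show ?thesis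
      using graph_iso_hitting_time[OF finite_connected_cell_graph[OF D] simple_closure_graph[OF simple]
          \<alpha>(1), of w' x' u' u] w' x' u' u \<alpha> by (simp add: cell_graph_verts[OF D])
  qed
  then show ?thesis by metis
qed simp

lemma cell_functions:
  assumes h: "\<forall>C\<in>cells X F. \<forall>w\<in>boundary X C. \<forall>x\<in>boundary X C. \<forall>u.
     x \<noteq> w \<longrightarrow> hitting_time (closure_graph X C) w u \<longrightarrow> u x = h"
    and C: "C \<in> cells X F" and v: "v \<in> boundary X C"
  shows "deriv (transition_function X C v) 1 = h / (of_nat (card (boundary X C)) - 1)"
    and "return_function X C v 1 = of_nat (degree (closure_graph X C) v) * of_nat (card (boundary X C)) * h
      / ((of_nat (card (boundary X C)) - 1) * of_nat (total_degree (closure_graph X C)))"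
proof -
  interpret G: finite_connected_graph "closure_graph X C"
    by (rule finite_connected_cell_graph[OF C])
  have Q: "Q_matrix X C B = G.walk_matrix B" for B
    by (simp add: fun_eq_iff Q_matrix_def G.walk_matrix_def)
  have "boundary X C \<subseteq> verts (closure_graph X C)"
    by (simp add: cell_graph_verts[OF C])
  note * = G.equidistant_hitting_times[OF this card_boundary_ge_2[OF C] v, of h]
  show "deriv (transition_function X C v) 1 = h / (of_nat (card (boundary X C)) - 1)"
    unfolding transition_function_def Q_star_def Q using *(1) h C by blast
  show "return_function X C v 1 = of_nat (degree (closure_graph X C) v) * of_nat (card (boundary X C)) * h
      / ((of_nat (card (boundary X C)) - 1) * of_nat (total_degree (closure_graph X C)))"
    unfolding return_function_def Q_star_def Q using *(2) h C by blast
qed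

lemma return_function_at_1:
  assumes C: "C \<in> cells X F" and v: "v \<in> boundary X C"
  shows "return_function X C v 1 = of_nat (branching_number X F \<psi>) * resistance_scaling X F \<psi>"
proof -
  define t where "t = card (boundary X C)"
  have t2: "t \<ge> 2" unfolding t_def by (rule card_boundary_ge_2[OF C])
  obtain h where h: "\<forall>C\<in>cells X F. \<forall>w\<in>boundary X C. \<forall>x\<in>boundary X C. \<forall>u.
     x \<noteq> w \<longrightarrow> hitting_time (closure_graph X C) w u \<longrightarrow> u x = h"
    by (rule exE[OF ex_boundary_hitting_time])
  have "deriv (transition_function X D w) 1 = h / (of_nat t - 1)"
    if "D \<in> cells X F" "w \<in> boundary X D" for D w
    using cell_functions(1)[OF h that] card_boundary_eq[OF that(1) C] by (simp add: t_def)
  then have \<tau>: "time_scaling X F = h / (of_nat t - 1)"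
    unfolding time_scaling_def using C v by (intro the_equality) auto
  define b where "b = branching_number X F \<psi>"
  define \<mu> where "\<mu> = mass_scaling X F \<psi>"
  have vV: "v \<in> verts X" using v by (simp add: boundary_def)
  have "b = card {D \<in> clique_cells C. \<psi> v \<in> boundary X D}"
    unfolding b_def branching_number_eq[OF C v] by (rule vertex_branching_eq[OF C vV])
  then have deg: "degree (closure_graph X C) v = (t - 1) * b"
    using degree_cell_graph[OF C] v by (simp add: t_def)
  have tot: "total_degree (closure_graph X C) = (t - 1) * (t * \<mu>)"
    unfolding t_def \<mu>_def mass_scaling_eq[OF C] by (rule total_degree_cell_graph[OF C])
  \<comment> \<open>To be used with \<open>a = t - 1\<close>, \<open>x = b\<close>,
    \<open>y = t\<close> and \<open>z = \<mu>\<close>. For \<open>z = 0\<close> both sides are 0 by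
    the convention for division by zero.\<close>
  have cancel: "(a * x) * y * h / (a * (a * (y * z))) = x * (h / a / z)"
    if "a \<noteq> 0" "y \<noteq> 0" for a x y z :: complex
    using that by (cases "z = 0") (simp_all add: field_simps)
  have t1: "of_nat t - 1 = (of_nat (t - 1) :: complex)"
    using t2 by simp
  have "return_function X C v 1 = of_nat b * (h / (of_nat t - 1) / of_nat \<mu>)"
    unfolding cell_functions(2)[OF h C v] t_def[symmetric] deg tot of_nat_mult t1
    by (rule cancel) (use t2 in auto)
  then show ?thesis
    unfolding resistance_scaling_def \<tau> b_def \<mu>_def .
qed

end

theorem theorem4:
  fixes X :: "'a graph" and F :: "'a set" and \<psi> :: "'a \<Rightarrow> 'a"
    and C :: "'a set" and v :: 'a
  assumes "symmetrically_self_similar X F \<psi>"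
    and "C \<in> cells X F" and "v \<in> boundary X C"
  shows "return_function X C v 1 =
           of_nat (branching_number X F \<psi>) * resistance_scaling X F \<psi>"
  by (intro symmetrically_self_similar_graph.return_function_at_1
      symmetrically_self_similar_graph.intro assms)

end
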